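(* Let $\lambda$ be a frequency, $\ell\ge 0$, and let $(f_N)_{N\ge1}$ be a bounded sequence in $H_{\infty,\ell}^{\lambda}[\mathrm{Re}>0]$. Assume that for every $n$ the limit $$a_n=\lim_{N\to\infty}a_n(f_N)$$ exists. Then there exists $f\in H_{\infty,\ell}^{\lambda}[\mathrm{Re}>0]$ such that $a_n(f)=a_n$ for all $n$, and for every $u>0$ $$f_N(u+\cdot)\to f(u+\cdot)\quad\text{in } H_{\infty,\ell}^{\lambda}[\mathrm{Re}>0]\text{ as }N\to\infty.$$
   Context: A frequency is a strictly increasing sequence $\lambda=(\lambda_n)_{n\ge 1}$ of non-negative real numbers with $\lambda_n\to\infty$. A $\lambda$-Dirichlet series is a formal series $D=\sum a_n e^{-\lambda_n s}$ with complex coefficients $a_n$. Write $[\mathrm{Re}>\sigma]=\{s\in\mathbb{C}:\mathrm{Re}\,s>\sigma\}$. A $\lambda$-Dirichlet series $D=\sum a_ne^{-\lambda_ns}$ is a $\lambda$-Riesz germ of a holomorphic function $f:[\mathrm{Re}>0]\to\mathbb{C}$ if for some $m\ge 0$ and some $\sigma\ge 0$ one has $f(s)=\lim_{x\to\infty}\sum_{\lambda_n<x}a_ne^{-\lambda_ns}\big(1-\frac{\lambda_n}{x}\big)^m$ for all $s\in[\mathrm{Re}>\sigma]$. A $\lambda$-Riesz germ, if it exists, is unique, and one writes $a_n(f):=a_n$ (the Bohr coefficients of $f$). For $\ell\ge 0$, $H_{\infty,\ell}^{\lambda}[\mathrm{Re}>0]$ is the linear space of all holomorphic $f:[\mathrm{Re}>0]\to\mathbb{C}$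 which have a $\lambda$-Riesz germ and satisfy $\|f\|_{\infty,\ell}=\sup_{\mathrm{Re}\,s>0}\frac{|f(s)|}{(1+|s|)^{\ell}}<\infty$. Convergence and boundedness in this space are with respect to $\|\cdot\|_{\infty,\ell}$, and $f(u+\cdot)$ denotes $s\mapsto f(u+s)$. *)

theory Defs
  imports "HOL-Complex_Analysis.Complex_Analysis"
begin

(* Sequences indexed by n >= 1 in the mathematical text are indexed by all of nat here. *)
definition frequency :: "(nat \<Rightarrow> real) \<Rightarrow> bool" where
  "frequency lam \<longleftrightarrow>
     strict_mono lam \<and> (\<forall>n. 0 \<le> lam n) \<and> filterlim lam at_top sequentially"

definition right_half_plane :: "real \<Rightarrow> complex set" where
  "right_half_plane \<sigma> = {s. \<sigma> < Re s}"

(* The order m may be any real number, hence powr.  For x > 0 the base is positive on the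
   range of summation, so powr is the usual power there, with value 1 for m = 0. *)
definition riesz_mean ::
    "(nat \<Rightarrow> real) \<Rightarrow> (nat \<Rightarrow> complex) \<Rightarrow> real \<Rightarrow> real \<Rightarrow> complex \<Rightarrow> complex" where
  "riesz_mean lam a m x s =
     (\<Sum>n | lam n < x.
        a n * exp (- complex_of_real (lam n) * s) * complex_of_real ((1 - lam n / x) powr m))"

(* A formal Dirichlet series over lam is identified with its coefficient sequence a.
   Functions on the half-plane are total functions whose values elsewhere play no role. *)
definition riesz_germ ::
    "(nat \<Rightarrow> real) \<Rightarrow> (nat \<Rightarrow> complex) \<Rightarrow> (complex \<Rightarrow> complex) \<Rightarrow> bool" where
  "riesz_germ lam a f \<longleftrightarrow>
     f holomorphic_on right_half_plane 0 \<and>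
     (\<exists>m\<ge>0. \<exists>\<sigma>\<ge>0. \<forall>s\<in>right_half_plane \<sigma>.
        ((\<lambda>x. riesz_mean lam a m x s) \<longlongrightarrow> f s) at_top)"

definition bohr_coeff ::
    "(nat \<Rightarrow> real) \<Rightarrow> (complex \<Rightarrow> complex) \<Rightarrow> nat \<Rightarrow> complex" where
  "bohr_coeff lam f = (THE a. riesz_germ lam a f)"

(* This is a supremum of reals, so it is meaningful only if the quotients are bounded;
   finiteness of the norm is the bdd_above condition in H_inf_space. *)
definition H_inf_norm :: "real \<Rightarrow> (complex \<Rightarrow> complex) \<Rightarrow> real" where
  "H_inf_norm l f = (SUP s\<in>right_half_plane 0. cmod (f s) / (1 + cmod s) powr l)"

definition H_inf_space :: "(nat \<Rightarrow> real) \<Rightarrow> real \<Rightarrow> (complex \<Rightarrow> complex) set" where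
  "H_inf_space lam l =
     {f. f holomorphic_on right_half_plane 0 \<and>
         (\<exists>a. riesz_germ lam a f) \<and>
         bdd_above ((\<lambda>s. cmod (f s) / (1 + cmod s) powr l) ` right_half_plane 0)}"

definition H_inf_tendsto ::
    "(nat \<Rightarrow> real) \<Rightarrow> real \<Rightarrow> (nat \<Rightarrow> complex \<Rightarrow> complex) \<Rightarrow> (complex \<Rightarrow> complex) \<Rightarrow> bool" where
  "H_inf_tendsto lam l F f \<longleftrightarrow>
     (\<forall>N. F N \<in> H_inf_space lam l) \<and> f \<in> H_inf_space lam l \<and>
     (\<lambda>N. H_inf_norm l (\<lambda>s. F N s - f s)) \<longlonglongrightarrow> 0"

end

(* Let k >= l + 2 be an integer.  Perron's formula with abscissa c = 1/x writes the k-th Riesz mean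
   of f at s as the integral of f(s + w) over the line Re w = 1/x against the kernel
   k!/(2 pi i) x^(-k) e^(xw) w^(-k-1).  The kernel has total mass 1 and concentrates at the scale
   1/x, and f' obeys the same growth bound as f on [Re > u], so the Riesz means of order k approximate
   f on [Re > u] with error O(1/x) (1 + |s|)^l, where the constant depends on f only through its norm.
   A Riesz mean is a finite sum, so convergence of the Bohr coefficients makes (f_N) a Cauchy sequence
   on every [Re > u] in the weighted norm; its limit inherits the growth bound and the error bound,
   and the latter says that the limit has the germ with coefficients a_n.

   A germ only supplies summability of some order m for large Re s.  It is turned into Perron's formula
   of high order by raising m to an integer p and bounding the Riesz means of order p by a power of
   |w| on vertical lines; differentiation in x then lowers the order to k, which is possible because of
   the growth bound, and Cauchy's theorem moves the line of integration to the abscissa 1/x. *)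

theory Submission
  imports Defs "HOL-Probability.Sinc_Integral"
begin

subsection \<open>Perron's formula for powers\<close>

text \<open>The order \<open>m\<close> and the abscissa \<open>\<sigma>\<close> of a germ are
  existential and may grow without bound along (f_N), so no constant obtained from a germ may enter
  the final estimate. They serve only to establish an identity: Perron's formula at a common order k
  no longer mentions them, and from there on every bound uses the norm alone. A further obstacle is
  that a germ converges only pointwise, with no uniformity on vertical lines, while Perron's formula
  needs an integrable majorant there; the way out is that bounded Riesz means at one point force
  polynomial growth on the line one unit to its right. The high-order formula also yields uniqueness
  of germs, on which the \<open>THE\<close> in \<open>bohr_coeff\<close> depends. All line integrals
  converge absolutely, with majorants M / (c^2 + t^2) = M / |w|^2. This explains k >= l + 2: the
  difference f(s + w) - f(s) grows like |w|^(l+1) and meets w^(-k-1).\<close>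

lemma inverse_sum_squares_integral:
  fixes c :: real assumes "c > 0"
  shows "integrable lborel (\<lambda>t. 1 / (c\<^sup>2 + t\<^sup>2))" "(LBINT t. 1 / (c\<^sup>2 + t\<^sup>2)) = pi / c"
proof -
  have i: "integrable lborel (\<lambda>x::real. inverse (1 + x\<^sup>2))"
    using integrable_inverse_1_plus_square by (simp add: set_integrable_def)
  have v: "(LBINT x. inverse (1 + x\<^sup>2)) = pi"
    using LBINT_inverse_1_plus_square
    by (simp add: interval_lebesgue_integral_def set_lebesgue_integral_def)
  have eq: "1 / (c\<^sup>2 + t\<^sup>2) = (1 / c\<^sup>2) * inverse (1 + (0 + (1 / c) * t)\<^sup>2)" for t
    using assms by (simp add: field_simps power2_eq_square)
  show "integrable lborel (\<lambda>t. 1 / (c\<^sup>2 + t\<^sup>2))"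
    unfolding eq using assms
    by (intro integrable_mult_right lborel_integrable_real_affine i) auto
  have "(LBINT x. inverse (1 + x\<^sup>2)) = \<bar>1 / c\<bar> *\<^sub>R (LBINT t. inverse (1 + (0 + (1 / c) * t)\<^sup>2))"
    using assms by (intro lborel_integral_real_affine) auto
  then have "(LBINT t. inverse (1 + (0 + (1 / c) * t)\<^sup>2)) = pi * c"
    using v assms by (simp add: field_simps)
  then show "(LBINT t. 1 / (c\<^sup>2 + t\<^sup>2)) = pi / c"
    unfolding eq using assms by (simp add: power2_eq_square)
qed

text \<open>The horizontal edges remain contour integrals because they are only estimated; the
  vertical ones become real integrals in t, ready for the limit of an infinitely tall rectangle.
  Parallel edges are given the same direction, hence the two minus signs.\<close>

lemma contour_integral_rectpath_eq:
  assumes "a < c" "b < d" "continuous_on (path_image (rectpath (Complex a b) (Complex c d))) g"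
  shows "contour_integral (rectpath (Complex a b) (Complex c d)) g =
    contour_integral (linepath (Complex a b) (Complex c b)) g
    + \<i> * integral {b..d} (\<lambda>t. g (Complex c t))
    - contour_integral (linepath (Complex a d) (Complex c d)) g
    - \<i> * integral {b..d} (\<lambda>t. g (Complex a t))"
proof -
  have cont: "continuous_on (closed_segment (Complex a b) (Complex c b)) g"
     "continuous_on (closed_segment (Complex c b) (Complex c d)) g"
     "continuous_on (closed_segment (Complex c d) (Complex a d)) g"
     "continuous_on (closed_segment (Complex a d) (Complex a b)) g"
    using assms(3)
    by (auto elim!: continuous_on_subset simp: rectpath_def Let_def path_image_join)
  note ci = cont[THEN contour_integrable_continuous_linepath]
  have "contour_integral (rectpath (Complex a b) (Complex c d)) g =
     contour_integral (linepath (Complex a b) (Complex c b)) g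
     + (contour_integral (linepath (Complex c b) (Complex c d)) g
     + (contour_integral (linepath (Complex c d) (Complex a d)) g
     + contour_integral (linepath (Complex a d) (Complex a b)) g))"
    using ci by (simp add: rectpath_def Let_def contour_integrable_joinI)
  moreover have "contour_integral (linepath (Complex c b) (Complex c d)) g
      = \<i> * integral {b..d} (\<lambda>t. g (Complex c t))"
    using assms by (intro contour_integral_linepath_same_Re) auto
  moreover have "contour_integral (linepath (Complex c d) (Complex a d)) g
      = - contour_integral (linepath (Complex a d) (Complex c d)) g"
    using contour_integral_reversepath[of "linepath (Complex a d) (Complex c d)" g] by simp
  moreover have "contour_integral (linepath (Complex a d) (Complex a b)) g
      = - contour_integral (linepath (Complex a b) (Complex a d)) g"
    using contour_integral_reversepath[of "linepath (Complex a b) (Complex a d)" g] by simp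
  moreover have "contour_integral (linepath (Complex a b) (Complex a d)) g
      = \<i> * integral {b..d} (\<lambda>t. g (Complex a t))"
    using assms by (intro contour_integral_linepath_same_Re) auto
  ultimately show ?thesis by simp
qed

lemma integral_symmetric_interval_tendsto:
  fixes h :: "real \<Rightarrow> complex"
  assumes "integrable lborel h"
  shows "(\<lambda>n. integral {- real n..real n} h) \<longlonglongrightarrow> (LBINT t. h t)"
proof -
  have eq: "(LBINT t:{- real n..real n}. h t) = integral {- real n..real n} h" for n
    by (rule set_borel_integral_eq_integral(2), rule set_integrable_subset[where A = UNIV])
       (use assms in \<open>simp_all add: set_integrable_def\<close>)
  have "(\<lambda>n. LBINT t:{- real n..real n}. h t) \<longlonglongrightarrow> (LBINT t. h t)"
    unfolding set_lebesgue_integral_def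
  proof (rule integral_dominated_convergence[where w = "\<lambda>t. norm (h t)"])
    show "AE t in lborel. (\<lambda>n. indicator {- real n..real n} t *\<^sub>R h t) \<longlonglongrightarrow> h t"
    proof (intro AE_I2 tendsto_eventually)
      fix t :: real
      obtain N :: nat where "\<bar>t\<bar> \<le> real N" using real_arch_simple by blast
      then show "\<forall>\<^sub>F n in sequentially. indicator {- real n..real n} t *\<^sub>R h t = h t"
        by (intro eventually_sequentiallyI[of N]) (auto split: split_indicator)
    qed
    show "AE t in lborel. norm (indicator {- real n..real n} t *\<^sub>R h t) \<le> norm (h t)" for n
      by (intro AE_I2) (simp split: split_indicator)
    show "h \<in> borel_measurable lborel" using assms by (rule borel_measurable_integrable)
    then show "(\<lambda>t. indicator {- real n..real n} t *\<^sub>R h t) \<in> borel_measurable lborel" for n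
      by (intro borel_measurable_scaleR) auto
    show "integrable lborel (\<lambda>t. norm (h t))" using assms by (rule integrable_norm)
  qed
  then show ?thesis unfolding eq .
qed

text \<open>Cauchy's theorem on the rectangle a <= Re w <= c, |Im w| <= n: each horizontal edge has
  the fixed length c - a and contributes at most M (c - a) / n^2.\<close>

lemma vertical_integral_shift:
  assumes hol: "g holomorphic_on {w. 0 < Re w}" and "0 < a" "a < c"
    and bound: "\<And>w. a \<le> Re w \<Longrightarrow> Re w \<le> c \<Longrightarrow> cmod (g w) \<le> M / (cmod w)\<^sup>2"
    and int: "integrable lborel (\<lambda>t. g (Complex a t))" "integrable lborel (\<lambda>t. g (Complex c t))"
  shows "(LBINT t. g (Complex a t)) = (LBINT t. g (Complex c t))"
proof -
  have M: "M \<ge> 0"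
  proof -
    have "0 \<le> M / (cmod (Complex a 0))\<^sup>2"
      using order_trans[OF norm_ge_zero bound[of "Complex a 0"]] assms by simp
    moreover have "cmod (Complex a 0) > 0" using assms by (simp add: complex_eq_iff)
    ultimately show ?thesis by (simp add: zero_le_divide_iff)
  qed
  define D where "D n = integral {- real n..real n} (\<lambda>t. g (Complex c t))
      - integral {- real n..real n} (\<lambda>t. g (Complex a t))" for n
  have le: "cmod (D n) \<le> 2 * (M * (c - a)) / (real n)\<^sup>2" if "n > 0" for n
  proof -
    let ?R = "rectpath (Complex a (- real n)) (Complex c (real n))"
    have sub: "path_image ?R \<subseteq> {w. 0 < Re w}"
      using path_image_rectpath_subset_cbox[of "Complex a (- real n)" "Complex c (real n)"] assms that
      by (auto simp: in_cbox_complex_iff)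
    have cont: "continuous_on {w. 0 < Re w} g" using hol holomorphic_on_imp_continuous_on by blast
    have "(g has_contour_integral 0) ?R"
      by (intro Cauchy_theorem_convex_simple[OF hol] convex_halfspace_Re_gt sub) auto
    then have "0 = contour_integral ?R g" using contour_integral_unique by metis
    also have "\<dots> = contour_integral (linepath (Complex a (- real n)) (Complex c (- real n))) g
      + \<i> * D n - contour_integral (linepath (Complex a (real n)) (Complex c (real n))) g"
      unfolding D_def using that assms continuous_on_subset[OF cont sub]
      by (subst contour_integral_rectpath_eq) (auto simp: algebra_simps)
    finally have "\<i> * D n = contour_integral (linepath (Complex a (real n)) (Complex c (real n))) g
       - contour_integral (linepath (Complex a (- real n)) (Complex c (- real n))) g"
      by (simp add: algebra_simps)
    then have "cmod (D n) = cmod (contour_integral (linepath (Complex a (real n)) (Complex c (real n))) g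
       - contour_integral (linepath (Complex a (- real n)) (Complex c (- real n))) g)"
      by (metis norm_mult norm_ii mult_1)
    note norm_D = this
    have "cmod (contour_integral (linepath (Complex a y) (Complex c y)) g) \<le> M * (c - a) / (real n)\<^sup>2"
      if y: "\<bar>y\<bar> = real n" for y
    proof -
      have seg: "a \<le> Re w \<and> Re w \<le> c \<and> Im w = y" if "w \<in> closed_segment (Complex a y) (Complex c y)" for w
        using that assms by (auto simp: closed_segment_same_Im closed_segment_eq_real_ivl)
      have "cmod (contour_integral (linepath (Complex a y) (Complex c y)) g)
          \<le> M / (real n)\<^sup>2 * cmod (Complex c y - Complex a y)"
      proof (rule contour_integral_bound_linepath)
        show "g contour_integrable_on linepath (Complex a y) (Complex c y)"
          using seg assms by (intro contour_integrable_continuous_linepath continuous_on_subset[OF cont]) force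
        show "0 \<le> M / (real n)\<^sup>2" using M by simp
        fix w assume w: "w \<in> closed_segment (Complex a y) (Complex c y)"
        have "real n \<le> cmod w" using seg[OF w] y abs_Im_le_cmod[of w] by auto
        then have "M / (cmod w)\<^sup>2 \<le> M / (real n)\<^sup>2" using M \<open>n > 0\<close>
          by (intro divide_left_mono power_mono mult_pos_pos) auto
        then show "cmod (g w) \<le> M / (real n)\<^sup>2" using bound[of w] seg[OF w] by auto
      qed
      also have "cmod (Complex c y - Complex a y) = c - a" using assms by (simp add: cmod_def)
      finally show ?thesis by simp
    qed
    from this[of "real n"] this[of "- real n"] show ?thesis
      unfolding norm_D by (intro order_trans[OF norm_triangle_ineq4]) auto
  qed
  have "D \<longlonglongrightarrow> 0"
  proof (rule Lim_null_comparison)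
    show "\<forall>\<^sub>F n in sequentially. cmod (D n) \<le> 2 * (M * (c - a)) / (real n)\<^sup>2"
      using le by (intro eventually_sequentiallyI[of 1]) auto
    show "(\<lambda>n. 2 * (M * (c - a)) / (real n)\<^sup>2) \<longlonglongrightarrow> 0" by real_asymp
  qed
  moreover have "D \<longlonglongrightarrow> (LBINT t. g (Complex c t)) - (LBINT t. g (Complex a t))"
    unfolding D_def by (intro tendsto_diff integral_symmetric_interval_tendsto int)
  ultimately have "(LBINT t. g (Complex c t)) - (LBINT t. g (Complex a t)) = 0"
    using LIMSEQ_unique by blast
  then show ?thesis by simp
qed

lemma higher_deriv_exp_linear: "(deriv ^^ n) (\<lambda>w. exp (y * w)) = (\<lambda>w::complex. y ^ n * exp (y * w))"
proof (induction n)
  case (Suc n)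
  have "deriv (\<lambda>w. y ^ n * exp (y * w)) w = y ^ Suc n * exp (y * w)" for w
    by (intro DERIV_imp_deriv) (auto intro!: derivative_eq_intros)
  then show ?case using Suc by auto
qed auto

lemma vertical_integrable:
  assumes "continuous_on {w. 0 < Re w} g" "0 < c"
    and "\<And>t. cmod (g (Complex c t)) \<le> M / (c\<^sup>2 + t\<^sup>2)"
  shows "integrable lborel (\<lambda>t. g (Complex c t))"
proof (rule Bochner_Integration.integrable_bound)
  show "integrable lborel (\<lambda>t. M * (1 / (c\<^sup>2 + t\<^sup>2)))"
    by (intro integrable_mult_right inverse_sum_squares_integral assms)
  have "continuous_on UNIV (\<lambda>t. g (Complex c t))"
    using assms(2) unfolding Complex_eq
    by (intro continuous_on_compose2[OF assms(1)] continuous_intros) auto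
  then show "(\<lambda>t. g (Complex c t)) \<in> borel_measurable lborel"
    by (simp add: borel_measurable_continuous_onI)
  show "AE t in lborel. cmod (g (Complex c t)) \<le> norm (M * (1 / (c\<^sup>2 + t\<^sup>2)))"
  proof (rule AE_I2)
    fix t :: real
    show "cmod (g (Complex c t)) \<le> norm (M * (1 / (c\<^sup>2 + t\<^sup>2)))"
      using order_trans[OF assms(3)[of t] abs_ge_self] by simp
  qed
qed

lemma norm_vertical_integral_le:
  assumes "0 < c" "\<And>t. cmod (h t) \<le> M / (c\<^sup>2 + t\<^sup>2)"
  shows "cmod (LBINT t. h t) \<le> M * pi / c"
proof -
  have "cmod (LBINT t. h t) \<le> (LBINT t. M * (1 / (c\<^sup>2 + t\<^sup>2)))"
  proof (rule order_trans[OF integral_norm_bound integral_mono_AE'])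
    show "integrable lborel (\<lambda>t. M * (1 / (c\<^sup>2 + t\<^sup>2)))"
      by (intro integrable_mult_right inverse_sum_squares_integral assms)
    show "AE t in lborel. cmod (h t) \<le> M * (1 / (c\<^sup>2 + t\<^sup>2))" using assms(2) by simp
    show "AE t in lborel. 0 \<le> M * (1 / (c\<^sup>2 + t\<^sup>2))"
      using order_trans[OF norm_ge_zero assms(2)] by simp
  qed
  also have "(LBINT t. M * (1 / (c\<^sup>2 + t\<^sup>2))) = M * pi / c"
    unfolding integral_mult_right_zero inverse_sum_squares_integral(2)[OF assms(1)] by simp
  finally show ?thesis .
qed

lemma cmod_Complex_power2: "(cmod (Complex c t))\<^sup>2 = c\<^sup>2 + t\<^sup>2"
  by (simp add: cmod_power2)

text \<open>Of the k + 1 factors 1/|w|, two are kept as the integrable 1/|w|^2 and the other k - 1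
  are estimated by |w| >= C.\<close>

lemma norm_exp_over_power_le:
  fixes y C :: real
  assumes "0 < C" "k \<ge> 1"
  shows "cmod (exp (of_real y * Complex C t) / Complex C t ^ Suc k) \<le> (exp (y * C) / C ^ (k - 1)) / (C\<^sup>2 + t\<^sup>2)"
proof -
  have "cmod (Complex C t) ^ Suc k = cmod (Complex C t) ^ (k - 1) * (C\<^sup>2 + t\<^sup>2)"
    unfolding cmod_Complex_power2[symmetric] power_add[symmetric]
    using assms(2) by (intro arg_cong[where f = "power _"]) auto
  moreover have "C ^ (k - 1) \<le> cmod (Complex C t) ^ (k - 1)"
    using assms abs_Re_le_cmod[of "Complex C t"] by (intro power_mono) auto
  moreover have "C\<^sup>2 + t\<^sup>2 > 0" using assms by (simp add: add_pos_nonneg)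
  ultimately show ?thesis
    using assms(1) unfolding norm_divide norm_power divide_divide_eq_left
    by (intro frac_le) (auto intro!: mult_right_mono)
qed

lemma perron_kernel_integrable:
  fixes y c :: real
  assumes "0 < c" "k \<ge> 1"
  shows "integrable lborel (\<lambda>t. exp (of_real y * Complex c t) / Complex c t ^ Suc k)"
proof (rule vertical_integrable[where g = "\<lambda>w. exp (of_real y * w) / w ^ Suc k"])
  show "cmod (exp (of_real y * Complex c t) / Complex c t ^ Suc k)
      \<le> (exp (y * c) / c ^ (k - 1)) / (c\<^sup>2 + t\<^sup>2)" for t
    by (rule norm_exp_over_power_le[OF assms])
qed (use assms in \<open>auto intro!: continuous_intros\<close>)

text \<open>For y <= 0 the factor |exp (y w)| is at most 1 on Re w > 0, so the line can be pushed to
  the right, where the bound is a constant times 1 / C. The value y = 0 is covered because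
  \<open>k \<ge> 1\<close> gives absolute convergence.\<close>

lemma perron_kernel_nonpos:
  fixes y c :: real
  assumes "0 < c" "k \<ge> 1" "y \<le> 0"
  shows "(CLBINT t. exp (of_real y * Complex c t) / Complex c t ^ Suc k) = 0"
    (is "?I = 0")
proof -
  let ?g = "\<lambda>w::complex. exp (of_real y * w) / w ^ Suc k"
  have le: "cmod ?I \<le> (1 / c ^ (k - 1)) * pi / C" if "C > c" for C
  proof -
    have "?I = (LBINT t. ?g (Complex C t))"
    proof (rule vertical_integral_shift[where a = c and c = C])
      show "?g holomorphic_on {w. 0 < Re w}" by (auto intro!: holomorphic_intros)
      show "cmod (?g w) \<le> (1 / c ^ (k - 1)) / (cmod w)\<^sup>2" if w: "c \<le> Re w" "Re w \<le> C" for w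
      proof -
        have "cmod (?g w) \<le> (exp (y * Re w) / Re w ^ (k - 1)) / (cmod w)\<^sup>2"
          using norm_exp_over_power_le[of "Re w" k y "Im w"] w assms
          by (simp add: cmod_power2)
        also have "\<dots> \<le> (1 / c ^ (k - 1)) / (cmod w)\<^sup>2"
          using w assms by (intro divide_right_mono frac_le power_mono) (auto simp: mult_nonpos_nonneg)
        finally show ?thesis .
      qed
    qed (use assms that perron_kernel_integrable in auto)
    also have "cmod \<dots> \<le> (1 / c ^ (k - 1)) * pi / C"
    proof (rule norm_vertical_integral_le)
      show "cmod (?g (Complex C t)) \<le> (1 / c ^ (k - 1)) / (C\<^sup>2 + t\<^sup>2)" for t
      proof -
        have "cmod (?g (Complex C t)) \<le> (exp (y * C) / C ^ (k - 1)) / (C\<^sup>2 + t\<^sup>2)"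
          using norm_exp_over_power_le[of C k y t] assms that by auto
        also have "\<dots> \<le> (1 / c ^ (k - 1)) / (C\<^sup>2 + t\<^sup>2)"
          using assms that by (intro divide_right_mono frac_le power_mono) (auto simp: mult_nonpos_nonneg)
        finally show ?thesis .
      qed
    qed (use assms that in auto)
    finally show ?thesis .
  qed
  have "((\<lambda>C. (1 / c ^ (k - 1)) * pi / C) \<longlongrightarrow> 0) at_top" by real_asymp
  then have "cmod ?I \<le> 0"
    by (rule tendsto_lowerbound) (use eventually_mono[OF eventually_gt_at_top[of c] le] in auto)
  then show ?thesis by simp
qed

text \<open>For y >= 0 the factor |exp (y w)| is at most exp (y c) to the left of the line. The
  rectangle is therefore closed on the left, around the pole at 0; its other three edges have length
  O(n) and distance at least n from 0, so they vanish in the limit.\<close>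

lemma perron_kernel_nonneg:
  fixes y c :: real
  assumes "0 < c" "k \<ge> 1" "y \<ge> 0"
  shows "(CLBINT t. exp (of_real y * Complex c t) / Complex c t ^ Suc k) = 2 * pi * of_real y ^ k / fact k"
    (is "?I = ?r")
proof -
  let ?g = "\<lambda>w::complex. exp (of_real y * w) / w ^ Suc k"
  define D where "D n = integral {- real n..real n} (\<lambda>t. ?g (Complex c t)) - ?r" for n
  have cont: "continuous_on (UNIV - {0}) ?g"
    by (intro holomorphic_on_imp_continuous_on holomorphic_intros) auto
  have gle: "cmod (?g w) \<le> exp (y * c) / (real n)\<^sup>2" if "n \<ge> 1" "real n \<le> cmod w" "Re w \<le> c" for n w
  proof -
    have "(real n)\<^sup>2 \<le> (cmod w)\<^sup>2" using that by (intro power_mono) auto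
    also have "\<dots> \<le> cmod w ^ Suc k" using that assms by (intro power_increasing) auto
    finally show ?thesis
      using that assms unfolding norm_divide norm_power norm_exp_eq_Re
      by (intro frac_le) (auto intro!: mult_left_mono)
  qed
  have seg: "cmod (contour_integral (linepath p q) ?g) \<le> exp (y * c) / (real n)\<^sup>2 * cmod (q - p)"
    if "n \<ge> 1" "\<And>w. w \<in> closed_segment p q \<Longrightarrow> real n \<le> cmod w \<and> Re w \<le> c" for p q n
  proof (rule contour_integral_bound_linepath)
    show "?g contour_integrable_on linepath p q"
      using that by (intro contour_integrable_continuous_linepath continuous_on_subset[OF cont]) force
    show "cmod (?g w) \<le> exp (y * c) / (real n)\<^sup>2" if "w \<in> closed_segment p q" for w
      using gle \<open>n \<ge> 1\<close> that \<open>\<And>w. w \<in> closed_segment p q \<Longrightarrow> real n \<le> cmod w \<and> Re w \<le> c\<close> by blast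
  qed auto
  have le: "cmod (D n) \<le> exp (y * c) * (2 * c + 4 * real n) / (real n)\<^sup>2" if n: "n \<ge> 1" for n
  proof -
    let ?p = "Complex (- real n) (- real n)" and ?q = "Complex c (real n)"
    let ?R = "rectpath ?p ?q"
    have img: "path_image ?R \<subseteq> UNIV - {0}"
      using n assms path_image_rectpath[of ?p ?q] by auto
    have "contour_integral ?R ?g = 2 * pi * \<i> * (\<Sum>p\<in>{0}. winding_number ?R p * residue ?g p)"
      using img by (intro Residue_theorem[of UNIV]) (auto intro!: holomorphic_intros)
    then have "contour_integral ?R ?g = 2 * pi * \<i> * (winding_number ?R 0 * residue ?g 0)"
      by simp
    also have "winding_number ?R 0 = 1"
      using n assms by (intro winding_number_rectpath) (auto simp: in_box_complex_iff)
    \<comment> \<open>The residue is the k-th Taylor coefficient of exp (y w) at 0, that is y^k /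
      k!.\<close>
    also have "residue ?g 0 = (deriv ^^ k) (\<lambda>w. exp (of_real y * w)) 0 / fact k"
      by (intro residue_holomorphic_over_power'[of UNIV]) (auto intro!: holomorphic_intros)
    finally have 1: "contour_integral ?R ?g = \<i> * ?r"
      by (simp add: higher_deriv_exp_linear)
    let ?L = "contour_integral (linepath ?p (Complex c (- real n))) ?g"
    let ?U = "contour_integral (linepath (Complex (- real n) (real n)) ?q) ?g"
    let ?W = "contour_integral (linepath ?p (Complex (- real n) (real n))) ?g"
    have W: "?W = \<i> * integral {- real n..real n} (\<lambda>t. ?g (Complex (- real n) t))"
      using n by (intro contour_integral_linepath_same_Re) auto
    have "contour_integral ?R ?g = ?L + \<i> * integral {- real n..real n} (\<lambda>t. ?g (Complex c t)) - ?U - ?W"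
      unfolding W using n assms by (intro contour_integral_rectpath_eq continuous_on_subset[OF cont img]) auto
    then have "\<i> * D n = ?U + ?W - ?L"
      unfolding 1 D_def by (simp add: algebra_simps)
    then have "cmod (D n) = cmod (?U + ?W - ?L)"
      by (metis norm_mult norm_ii mult_1)
    also have "\<dots> \<le> cmod ?U + cmod ?W + cmod ?L"
      by (meson add_right_mono norm_triangle_ineq norm_triangle_ineq4 order_trans)
    also have "\<dots> \<le> exp (y * c) / (real n)\<^sup>2 * (c + real n) + exp (y * c) / (real n)\<^sup>2 * (2 * real n)
        + exp (y * c) / (real n)\<^sup>2 * (c + real n)"
    proof (intro add_mono)
      have *: "\<bar>Re w\<bar> \<le> cmod w" "\<bar>Im w\<bar> \<le> cmod w" for w
        by (rule abs_Re_le_cmod abs_Im_le_cmod)+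
      have "cmod ?U \<le> exp (y * c) / (real n)\<^sup>2 * cmod (?q - Complex (- real n) (real n))"
      proof (rule seg[OF n])
        fix w assume "w \<in> closed_segment (Complex (- real n) (real n)) ?q"
        then have "Im w = real n" "Re w \<le> c" using assms
          by (auto simp: closed_segment_same_Im closed_segment_eq_real_ivl)
        then show "real n \<le> cmod w \<and> Re w \<le> c" using *[of w] by auto
      qed
      then show "cmod ?U \<le> exp (y * c) / (real n)\<^sup>2 * (c + real n)"
        using assms by (simp add: cmod_def)
      have "cmod ?L \<le> exp (y * c) / (real n)\<^sup>2 * cmod (Complex c (- real n) - ?p)"
      proof (rule seg[OF n])
        fix w assume "w \<in> closed_segment ?p (Complex c (- real n))"
        then have "Im w = - real n" "Re w \<le> c" using assms
          by (auto simp: closed_segment_same_Im closed_segment_eq_real_ivl)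
        then show "real n \<le> cmod w \<and> Re w \<le> c" using *[of w] by auto
      qed
      then show "cmod ?L \<le> exp (y * c) / (real n)\<^sup>2 * (c + real n)"
        using assms by (simp add: cmod_def)
      have "cmod ?W \<le> exp (y * c) / (real n)\<^sup>2 * cmod (Complex (- real n) (real n) - ?p)"
      proof (rule seg[OF n])
        fix w assume "w \<in> closed_segment ?p (Complex (- real n) (real n))"
        then have "Re w = - real n"
          by (auto simp: closed_segment_same_Re)
        then show "real n \<le> cmod w \<and> Re w \<le> c" using *[of w] assms by auto
      qed
      also have "Complex (- real n) (real n) - ?p = of_real (2 * real n) * \<i>"
        by (simp add: complex_eq_iff)
      finally show "cmod ?W \<le> exp (y * c) / (real n)\<^sup>2 * (2 * real n)"
        by (simp add: norm_mult)
    qed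
    also have "\<dots> = exp (y * c) * (2 * c + 4 * real n) / (real n)\<^sup>2"
      by (simp add: add_divide_distrib[symmetric] algebra_simps)
    finally show ?thesis .
  qed
  have "D \<longlonglongrightarrow> 0"
  proof (rule Lim_null_comparison)
    show "\<forall>\<^sub>F n in sequentially. cmod (D n) \<le> exp (y * c) * (2 * c + 4 * real n) / (real n)\<^sup>2"
      using le by (intro eventually_sequentiallyI[of 1]) auto
    show "(\<lambda>n. exp (y * c) * (2 * c + 4 * real n) / (real n)\<^sup>2) \<longlonglongrightarrow> 0" by real_asymp
  qed
  moreover have "D \<longlonglongrightarrow> ?I - ?r"
    unfolding D_def
    by (intro tendsto_diff integral_symmetric_interval_tendsto perron_kernel_integrable assms tendsto_const)
  ultimately have "?I - ?r = 0" using LIMSEQ_unique by blast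
  then show ?thesis by simp
qed

text \<open>Here \<open>max 0\<close> is the source of the cut-off \<open>lam n < x\<close>: with y
  = x - lam n, the terms beyond the cut-off integrate to 0.\<close>

lemma perron_kernel:
  fixes y c :: real
  assumes "0 < c" "k \<ge> 1"
  shows "(CLBINT t. exp (of_real y * Complex c t) / Complex c t ^ Suc k)
    = 2 * pi / fact k * of_real (max 0 y ^ k)"
  using perron_kernel_nonpos[OF assms, of y] perron_kernel_nonneg[OF assms, of y] assms
  by (cases "y \<le> 0") (auto simp: max_def)

subsection \<open>Riesz means\<close>

lemma frequency_nonneg: "frequency lam \<Longrightarrow> 0 \<le> lam n"
  by (simp add: frequency_def)

lemma frequency_less_iff: "frequency lam \<Longrightarrow> lam i < lam j \<longleftrightarrow> i < j"
  by (auto simp: frequency_def strict_mono_less)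

lemma frequency_finite_less:
  assumes "frequency lam"
  shows "finite {n. lam n < x}"
proof -
  have "eventually (\<lambda>n. x \<le> lam n) sequentially"
    using assms by (simp add: frequency_def filterlim_at_top)
  then obtain N where "\<And>n. n \<ge> N \<Longrightarrow> x \<le> lam n" by (auto simp: eventually_sequentially)
  then have "{n. lam n < x} \<subseteq> {..<N}" by (force simp: not_le[symmetric])
  then show ?thesis using finite_subset by blast
qed

section \<open>Raising the order of a Riesz mean\<close>

text \<open>For t > r the integrand is (t - r)^m (1 - t)^(q-1), and the substitution v = (t - r) /
  (1 - r) turns it into the Beta integrand times a power of 1 - r.\<close>

lemma has_integral_Beta_truncated:
  fixes r m q :: real
  assumes "0 \<le> r" "r < 1" "0 \<le> m" "0 < q"
  shows "((\<lambda>t. if r < t then (1 - r / t) powr m * (t powr m * (1 - t) powr (q - 1)) else 0)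
    has_integral (1 - r) powr (m + q) * Beta (m + 1) q) {0..1}"
proof -
  let ?f = "\<lambda>v. v powr m * (1 - v) powr (q - 1)"
  have B: "(?f has_integral Beta (m + 1) q) (cbox 0 1)"
    using has_integral_Beta_real[of "m + 1" q] assms by simp
  \<comment> \<open>The left side is the form in which \<open>has_integral_affinity\<close> returns
    the transformed interval; the map is just x to (1 - r) x + r.\<close>
  have img: "(\<lambda>x. (1 / (1 / (1 - r))) *\<^sub>R x + - ((1 / (1 / (1 - r))) *\<^sub>R (- r / (1 - r)))) ` cbox 0 1 = {r..1}"
  proof -
    have "(\<lambda>x. (1 / (1 / (1 - r))) *\<^sub>R x + - ((1 / (1 / (1 - r))) *\<^sub>R (- r / (1 - r)))) = (\<lambda>x. (1 - r) * x + r)"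
      using assms by (auto simp: field_simps)
    then show ?thesis using assms image_affinity_atLeastAtMost[of "1 - r" r 0 1] by simp
  qed
  have "((\<lambda>t. ?f ((1 / (1 - r)) *\<^sub>R t + - r / (1 - r))) has_integral (1 - r) * Beta (m + 1) q) {r..1}"
    using has_integral_affinity[OF B, of "1 / (1 - r)" "- r / (1 - r)"] assms unfolding img by simp
  then have "((\<lambda>t. (1 - r) powr (m + q - 1) * ?f ((1 / (1 - r)) *\<^sub>R t + - r / (1 - r)))
      has_integral (1 - r) powr (m + q - 1) * ((1 - r) * Beta (m + 1) q)) {r..1}"
    by (rule has_integral_mult_right)
  moreover have "(1 - r) powr (m + q - 1) * ((1 - r) * Beta (m + 1) q) = (1 - r) powr (m + q) * Beta (m + 1) q"
    using assms by (simp add: powr_diff)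
  ultimately have "((\<lambda>t. (1 - r) powr (m + q - 1) * ?f ((1 / (1 - r)) *\<^sub>R t + - r / (1 - r)))
      has_integral (1 - r) powr (m + q) * Beta (m + 1) q) {r..1}" by simp
  then have "((\<lambda>t. if t \<in> {r..1} then (1 - r) powr (m + q - 1) * ?f ((1 / (1 - r)) *\<^sub>R t + - r / (1 - r)) else 0)
      has_integral (1 - r) powr (m + q) * Beta (m + 1) q) {0..1}"
    using assms by (subst has_integral_restrict) auto
  then show ?thesis
  proof (rule has_integral_spike_finite[where S = "{r}", rotated 2])
    fix t assume t: "t \<in> {0..1} - {r}"
    show "(if r < t then (1 - r / t) powr m * (t powr m * (1 - t) powr (q - 1)) else 0)
      = (if t \<in> {r..1} then (1 - r) powr (m + q - 1) * ?f ((1 / (1 - r)) *\<^sub>R t + - r / (1 - r)) else 0)"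
    proof (cases "r < t")
      case True
      have "(1 / (1 - r)) *\<^sub>R t + - r / (1 - r) = (t - r) / (1 - r)"
        using assms by (simp add: diff_divide_distrib)
      moreover have "1 - (t - r) / (1 - r) = (1 - t) / (1 - r)"
        using assms by (simp add: field_simps)
      moreover have "(1 - r / t) powr m * t powr m = (t - r) powr m"
        using True assms by (subst powr_mult[symmetric]) (auto simp: left_diff_distrib)
      moreover have "(1 - r) powr (m + q - 1) = (1 - r) powr m * (1 - r) powr (q - 1)"
        by (subst powr_add[symmetric]) (simp add: algebra_simps)
      ultimately show ?thesis
        using True t assms by (simp add: powr_divide mult.assoc[symmetric])
    qed (use t in auto)
  qed auto
qed

text \<open>Applying the Beta integral with r = lam n / x to each term shows that the mean of order
  m + q at x is a weighted average of the means of order m at the points x t, the weight being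
  nonnegative with total mass \<open>Beta (m + 1) q\<close>.\<close>

lemma riesz_mean_raise_order:
  assumes "frequency lam" "0 \<le> m" "0 < q" "0 < x"
  shows "((\<lambda>t. riesz_mean lam a m (x * t) s * complex_of_real (t powr m * (1 - t) powr (q - 1)))
    has_integral riesz_mean lam a (m + q) x s * complex_of_real (Beta (m + 1) q)) {0..1}"
proof -
  let ?A = "{n. lam n < x}"
  let ?h = "\<lambda>n t. if lam n / x < t then (1 - lam n / x / t) powr m * (t powr m * (1 - t) powr (q - 1)) else 0"
  have fin: "finite ?A" using frequency_finite_less assms by blast
  have 1: "((\<lambda>t. \<Sum>n\<in>?A. (a n * exp (- complex_of_real (lam n) * s)) * complex_of_real (?h n t))
    has_integral (\<Sum>n\<in>?A. (a n * exp (- complex_of_real (lam n) * s))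
        * complex_of_real ((1 - lam n / x) powr (m + q) * Beta (m + 1) q))) {0..1}"
    using assms frequency_nonneg[OF assms(1)]
    by (intro has_integral_sum fin has_integral_mult_right has_integral_of_real has_integral_Beta_truncated) auto
  have 2: "(\<Sum>n\<in>?A. (a n * exp (- complex_of_real (lam n) * s)) * complex_of_real (?h n t))
     = riesz_mean lam a m (x * t) s * complex_of_real (t powr m * (1 - t) powr (q - 1))" if "t \<in> {0..1}" for t
  proof -
    have "riesz_mean lam a m (x * t) s * complex_of_real (t powr m * (1 - t) powr (q - 1)) =
      (\<Sum>n\<in>{n\<in>?A. lam n / x < t}. a n * exp (- complex_of_real (lam n) * s) * complex_of_real (?h n t))"
      unfolding riesz_mean_def sum_distrib_right
    proof (rule sum.cong)
      have "x * t \<le> x"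
        using mult_left_mono[of t 1 x] assms \<open>t \<in> {0..1}\<close> by auto
      then have "lam n < x" if "lam n < x * t" for n
        using that by linarith
      then show "{n. lam n < x * t} = {n\<in>?A. lam n / x < t}"
        using assms by (auto simp: field_simps)
    qed (simp add: field_simps)
    also have "\<dots> = (\<Sum>n\<in>?A. (a n * exp (- complex_of_real (lam n) * s)) * complex_of_real (?h n t))"
      using fin by (intro sum.mono_neutral_left) auto
    finally show ?thesis ..
  qed
  have 3: "(\<Sum>n\<in>?A. (a n * exp (- complex_of_real (lam n) * s))
        * complex_of_real ((1 - lam n / x) powr (m + q) * Beta (m + 1) q))
      = riesz_mean lam a (m + q) x s * complex_of_real (Beta (m + 1) q)"
    by (simp add: riesz_mean_def sum_distrib_right mult.assoc)
  show ?thesis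
    using has_integral_eq[OF 2 1] unfolding 3 .
qed

text \<open>Convergence bounds the means for x >= X only. Below X finitely many terms are involved,
  and the weights (1 - lam n / x)^m are at most 1.\<close>

lemma convergent_riesz_mean_bounded:
  assumes "frequency lam" "0 \<le> m" "((\<lambda>x. riesz_mean lam a m x s) \<longlongrightarrow> L) at_top"
  obtains M where "\<And>x. 0 < x \<Longrightarrow> cmod (riesz_mean lam a m x s) \<le> M"
proof -
  have "eventually (\<lambda>x. cmod (riesz_mean lam a m x s) < cmod L + 1) at_top"
    by (intro order_tendstoD(2)[OF tendsto_norm[OF assms(3)]]) auto
  then obtain X where X: "\<And>x. x \<ge> X \<Longrightarrow> cmod (riesz_mean lam a m x s) < cmod L + 1"
    by (auto simp: eventually_at_top_linorder)
  let ?S = "\<Sum>n | lam n < X. cmod (a n * exp (- complex_of_real (lam n) * s))"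
  have small: "cmod (riesz_mean lam a m x s) \<le> ?S" if "0 < x" "x \<le> X" for x
  proof -
    have "cmod (riesz_mean lam a m x s) \<le> (\<Sum>n | lam n < x. cmod (a n * exp (- complex_of_real (lam n) * s)))"
      unfolding riesz_mean_def
    proof (rule sum_norm_le)
      fix n assume "n \<in> {n. lam n < x}"
      then have "(1 - lam n / x) powr m \<le> 1"
        using that frequency_nonneg[OF assms(1), of n] assms(2) by (intro powr_le1) auto
      then show "cmod (a n * exp (- complex_of_real (lam n) * s) * complex_of_real ((1 - lam n / x) powr m))
          \<le> cmod (a n * exp (- complex_of_real (lam n) * s))"
        by (simp add: norm_mult mult_left_le)
    qed
    also have "\<dots> \<le> ?S"
      using that by (intro sum_mono2 frequency_finite_less assms(1)) auto
    finally show ?thesis .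
  qed
  show ?thesis
  proof
    fix x :: real assume "0 < x"
    then show "cmod (riesz_mean lam a m x s) \<le> max ?S (cmod L + 1)"
      using small[of x] X[of x] by (cases "x \<le> X") auto
  qed
qed

text \<open>Dominated convergence in the averaging formula: for each fixed t > 0 the points X k * t
  tend to infinity, and the bound on all means of order m is the majorant. The limit is taken along
  sequences because dominated convergence is sequential.\<close>

lemma riesz_mean_raise_order_tendsto:
  assumes "frequency lam" "0 \<le> m" "0 < q" "((\<lambda>x. riesz_mean lam a m x s) \<longlongrightarrow> L) at_top"
  shows "((\<lambda>x. riesz_mean lam a (m + q) x s) \<longlongrightarrow> L) at_top"
proof (rule tendsto_at_topI_sequentially)
  fix X :: "nat \<Rightarrow> real" assume X: "filterlim X at_top sequentially"
  obtain M where bd: "\<And>x. 0 < x \<Longrightarrow> cmod (riesz_mean lam a m x s) \<le> M"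
    using convergent_riesz_mean_bounded[OF assms(1,2,4)] by blast
  let ?d = "\<lambda>t. t powr m * (1 - t) powr (q - 1)"
  let ?g = "\<lambda>k t. riesz_mean lam a m (X k * t) s * complex_of_real (?d t)"
  have B: "(?d has_integral Beta (m + 1) q) {0..1}"
    using has_integral_Beta_real[of "m + 1" q] assms by simp
  have pos: "Beta (m + 1) q > 0" using assms by (simp add: Beta_def Gamma_real_pos)
  obtain N where N: "\<And>k. k \<ge> N \<Longrightarrow> X k > 0"
    using X by (auto simp: filterlim_at_top_dense eventually_sequentially)
  note R = riesz_mean_raise_order[OF assms(1-3) N, of _ a s]
  have lim: "(\<lambda>k. integral {0..1} (?g (k + N))) \<longlonglongrightarrow> integral {0..1} (\<lambda>t. L * complex_of_real (?d t))"
  proof (rule dominated_convergence(2))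
    show "?g (k + N) integrable_on {0..1}" for k using R[of "k + N"] by auto
    show "(\<lambda>t. M * ?d t) integrable_on {0..1}"
      using has_integral_mult_right[OF B] by blast
    \<comment> \<open>At t = 0 the bound on the means says nothing, but the weight vanishes there:
      \<open>0 powr m\<close> is 0, even for m = 0.\<close>
    show "cmod (?g (k + N) t) \<le> M * ?d t" if "t \<in> {0..1}" for k t
    proof (cases "t = 0")
      case False
      then show ?thesis using bd[of "X (k + N) * t"] N[of "k + N"] that
        by (simp add: norm_mult mult_right_mono)
    qed simp
    show "(\<lambda>k. ?g (k + N) t) \<longlonglongrightarrow> L * complex_of_real (?d t)" if "t \<in> {0..1}" for t
    proof (cases "t = 0")
      case False
      have "filterlim (\<lambda>k. X k * t) at_top sequentially"
        using False that X by (intro filterlim_at_top_mult_tendsto_pos[OF tendsto_const]) auto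
      then have "(\<lambda>k. riesz_mean lam a m (X k * t) s) \<longlonglongrightarrow> L"
        using assms(4) by (rule filterlim_compose[rotated])
      then show ?thesis
        by (intro tendsto_mult tendsto_const LIMSEQ_ignore_initial_segment)
    qed simp
  qed
  have "integral {0..1} (\<lambda>t. L * complex_of_real (?d t)) = L * complex_of_real (Beta (m + 1) q)"
    by (intro integral_unique has_integral_mult_right has_integral_of_real B)
  moreover have "integral {0..1} (?g (k + N)) = riesz_mean lam a (m + q) (X (k + N)) s * complex_of_real (Beta (m + 1) q)" for k
    using R[of "k + N"] by (intro integral_unique) auto
  ultimately have "(\<lambda>k. riesz_mean lam a (m + q) (X (k + N)) s * complex_of_real (Beta (m + 1) q)
     / complex_of_real (Beta (m + 1) q)) \<longlonglongrightarrow> L * complex_of_real (Beta (m + 1) q) / complex_of_real (Beta (m + 1) q)"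
    using lim pos by (intro tendsto_divide tendsto_const) auto
  then have "(\<lambda>k. riesz_mean lam a (m + q) (X (k + N)) s) \<longlonglongrightarrow> L" using pos by simp
  then show "(\<lambda>k. riesz_mean lam a (m + q) (X k) s) \<longlonglongrightarrow> L"
    by (rule LIMSEQ_offset)
qed

subsection \<open>Growth of Riesz means on vertical lines\<close>

text \<open>
  Let I g be the primitive of g that vanishes at 0, and let S be a sum of terms b (x - \<mu>)^p
  truncated at x = \<mu>. Conjugating the derivative D with e^(-xw) gives D + w, so the corresponding
  sum T of the terms b e^(-\<mu>w) (x - \<mu>)^p equals (1 + w I)^(p+1) (e^(-xw) S), which bounds T by
  a polynomial in w.
\<close>

definition volterra :: "complex \<Rightarrow> (real \<Rightarrow> complex) \<Rightarrow> real \<Rightarrow> complex" where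
  "volterra w g = (\<lambda>x. g x + w * integral {0..x} g)"

definition loc_integrable :: "(real \<Rightarrow> complex) \<Rightarrow> bool" where
  "loc_integrable g \<longleftrightarrow> (\<forall>x. g integrable_on {0..x})"

text \<open>One family contains both sides of the identity to be proved: w = 0 gives the plain
  truncated power of T, and general w gives the terms of exp (-x w) S.\<close>

definition truncated_power :: "complex \<Rightarrow> real \<Rightarrow> nat \<Rightarrow> real \<Rightarrow> complex" where
  "truncated_power w \<mu> j x = (if \<mu> < x then exp (- w * of_real x) * of_real (x - \<mu>) ^ j else 0)"

lemma loc_integrable_primitive:
  assumes "loc_integrable g"
  shows "loc_integrable (\<lambda>x. c * integral {0..x} g)"
  unfolding loc_integrable_def
proof
  fix x :: real
  have "continuous_on {0..x} (\<lambda>x. integral {0..x} g)"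
    using assms by (intro indefinite_integral_continuous_1) (simp add: loc_integrable_def)
  then show "(\<lambda>x. c * integral {0..x} g) integrable_on {0..x}"
    by (intro integrable_continuous_interval continuous_intros)
qed

lemma loc_integrable_add:
  "loc_integrable g \<Longrightarrow> loc_integrable h \<Longrightarrow> loc_integrable (\<lambda>x. g x + h x)"
  by (simp add: loc_integrable_def integrable_add)

lemma loc_integrable_mult: "loc_integrable g \<Longrightarrow> loc_integrable (\<lambda>x. c * g x)"
  unfolding loc_integrable_def by (auto intro: integrable_on_mult_right)

lemma loc_integrable_sum:
  "finite A \<Longrightarrow> (\<And>n. n \<in> A \<Longrightarrow> loc_integrable (g n)) \<Longrightarrow> loc_integrable (\<lambda>x. \<Sum>n\<in>A. g n x)"
  by (auto simp: loc_integrable_def intro!: integrable_sum)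

lemma loc_integrable_volterra: "loc_integrable g \<Longrightarrow> loc_integrable (volterra w g)"
  unfolding volterra_def by (intro loc_integrable_add loc_integrable_primitive)

lemma loc_integrable_volterra_iter:
  "loc_integrable g \<Longrightarrow> loc_integrable ((volterra w ^^ i) g)"
  by (induction i) (auto intro: loc_integrable_volterra)

text \<open>Both operators are polynomials in the integration operator I, so they commute. This lets
  an induction on the exponent pull one integration to the front.\<close>

lemma volterra_primitive:
  assumes "loc_integrable g"
  shows "volterra w (\<lambda>x. c * integral {0..x} g) = (\<lambda>x. c * integral {0..x} (volterra w g))"
proof
  fix x
  have "integral {0..x} (volterra w g) = integral {0..x} g + integral {0..x} (\<lambda>x. w * integral {0..x} g)"
    unfolding volterra_def using assms loc_integrable_primitive[OF assms, of w]
    by (intro integral_add) (auto simp: loc_integrable_def)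
  then show "volterra w (\<lambda>x. c * integral {0..x} g) x = c * integral {0..x} (volterra w g)"
    by (simp add: volterra_def algebra_simps)
qed

lemma volterra_iter_primitive:
  assumes "loc_integrable g"
  shows "(volterra w ^^ i) (\<lambda>x. c * integral {0..x} g) = (\<lambda>x. c * integral {0..x} ((volterra w ^^ i) g))"
  by (induction i) (simp_all add: volterra_primitive[OF loc_integrable_volterra_iter[OF assms]])

lemma volterra_iter_sum:
  assumes "finite A" "\<And>n. n \<in> A \<Longrightarrow> loc_integrable (g n)"
  shows "(volterra w ^^ i) (\<lambda>x. \<Sum>n\<in>A. b n * g n x) = (\<lambda>x. \<Sum>n\<in>A. b n * (volterra w ^^ i) (g n) x)"
proof (induction i)
  case (Suc i)
  have "integral {0..x} (\<lambda>x. \<Sum>n\<in>A. b n * (volterra w ^^ i) (g n) x)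
      = (\<Sum>n\<in>A. b n * integral {0..x} ((volterra w ^^ i) (g n)))" for x
    using assms loc_integrable_mult[OF loc_integrable_volterra_iter[OF assms(2)]]
    by (subst integral_sum) (auto simp: loc_integrable_def)
  then show ?case
    unfolding funpow.simps o_apply Suc
    by (simp add: volterra_def[of w] sum_distrib_left sum.distrib distrib_left mult.left_commute)
qed simp

lemma has_integral_truncated:
  fixes H h :: "real \<Rightarrow> complex"
  assumes "\<And>t. (H has_vector_derivative h t) (at t)" "0 \<le> \<mu>"
  shows "((\<lambda>t. if \<mu> < t then h t else 0) has_integral (if \<mu> < x then H x - H \<mu> else 0)) {0..x}"
proof (cases "\<mu> < x")
  case True
  have "(h has_integral H x - H \<mu>) {\<mu>..x}"
    using True assms by (intro fundamental_theorem_of_calculus) (auto intro: has_vector_derivative_at_within)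
  then have "((\<lambda>t. if t \<in> {\<mu>..x} then h t else 0) has_integral H x - H \<mu>) {0..x}"
    using assms by (subst has_integral_restrict) auto
  then have "((\<lambda>t. if \<mu> < t then h t else 0) has_integral H x - H \<mu>) {0..x}"
    by (rule has_integral_spike_finite[where S = "{\<mu>}", rotated 2]) auto
  then show ?thesis using True by simp
next
  case False
  then have "((\<lambda>t. if \<mu> < t then h t else 0) has_integral 0) {0..x}"
    by (intro has_integral_is_0) auto
  then show ?thesis using False by simp
qed

lemma has_vector_derivative_exp_linear:
  fixes w :: complex
  shows
  "((\<lambda>t. exp (- w * of_real t)) has_vector_derivative - w * exp (- w * of_real t)) (at t)"
proof -
  have "((\<lambda>z. exp (- w * z)) has_field_derivative - w * exp (- w * of_real t)) (at (of_real t))"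
    by (auto intro!: derivative_eq_intros)
  from has_vector_derivative_real_field[OF this] show ?thesis .
qed

lemma has_vector_derivative_exp_linear_power:
  fixes w :: complex
  shows
  "((\<lambda>t. exp (- w * of_real t) * of_real (t - \<mu>) ^ Suc j) has_vector_derivative
    - w * (exp (- w * of_real t) * of_real (t - \<mu>) ^ Suc j)
      + of_nat (Suc j) * (exp (- w * of_real t) * of_real (t - \<mu>) ^ j)) (at t)"
proof -
  have "((\<lambda>z. exp (- w * z) * (z - of_real \<mu>) ^ Suc j) has_field_derivative
    - w * (exp (- w * of_real t) * (of_real t - of_real \<mu>) ^ Suc j)
      + of_nat (Suc j) * (exp (- w * of_real t) * (of_real t - of_real \<mu>) ^ j)) (at (of_real t))"
    by (rule derivative_eq_intros refl | simp)+
  from has_vector_derivative_real_field[OF this] show ?thesis by simp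
qed

lemma loc_integrable_truncated_power:
  assumes "0 \<le> \<mu>"
  shows "loc_integrable (truncated_power w \<mu> j)"
  unfolding loc_integrable_def
proof
  fix x
  let ?h = "\<lambda>t. exp (- w * of_real t) * of_real (t - \<mu>) ^ j"
  have "?h integrable_on {\<mu>..x}"
    by (intro integrable_continuous_interval continuous_intros)
  then have "(\<lambda>t. if t \<in> {\<mu>..x} then ?h t else 0) integrable_on {0..x}"
    using assms by (subst integrable_restrict_Int) (auto simp: Int_absorb1)
  then show "truncated_power w \<mu> j integrable_on {0..x}"
    by (rule integrable_spike_finite[where S = "{\<mu>}", rotated 2]) (auto simp: truncated_power_def)
qed

text \<open>Beyond \<open>\<mu>\<close>, w times the integral of exp (-w t) is exp (-w
  \<open>\<mu>\<close>) - exp (-w x), and the last term cancels the function itself.\<close>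

lemma volterra_truncated_power_0:
  assumes "0 \<le> \<mu>"
  shows "volterra w (truncated_power w \<mu> 0) = (\<lambda>x. exp (- w * of_real \<mu>) * truncated_power 0 \<mu> 0 x)"
proof
  fix x
  have "((\<lambda>t. if \<mu> < t then - w * exp (- w * of_real t) else 0) has_integral
     (if \<mu> < x then exp (- w * of_real x) - exp (- w * of_real \<mu>) else 0)) {0..x}"
    by (rule has_integral_truncated[OF has_vector_derivative_exp_linear assms])
  also have "(\<lambda>t. if \<mu> < t then - w * exp (- w * of_real t) else 0) = (\<lambda>t. - w * truncated_power w \<mu> 0 t)"
    by (auto simp: truncated_power_def)
  finally have "- w * integral {0..x} (truncated_power w \<mu> 0)
      = (if \<mu> < x then exp (- w * of_real x) - exp (- w * of_real \<mu>) else 0)"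
    unfolding integral_mult_right[symmetric] by (rule integral_unique)
  then have "w * integral {0..x} (truncated_power w \<mu> 0)
      = (if \<mu> < x then exp (- w * of_real \<mu>) - exp (- w * of_real x) else 0)"
    by (auto split: if_splits simp: algebra_simps minus_equation_iff)
  then show "volterra w (truncated_power w \<mu> 0) x = exp (- w * of_real \<mu>) * truncated_power 0 \<mu> 0 x"
    by (simp add: volterra_def) (simp add: truncated_power_def)
qed

text \<open>Fundamental theorem for exp (-w t) (t - \<open>\<mu>\<close>)^(j+1), whose boundary term
  at \<open>\<mu>\<close> is 0. For general w it says that 1 + w I trades the exponent j + 1 for j
  and one integration; for w = 0 it says that integration raises the exponent of the plain
  power.\<close>

lemma integral_truncated_power_Suc:
  assumes "0 \<le> \<mu>"
  shows "w * integral {0..x} (truncated_power w \<mu> (Suc j)) + truncated_power w \<mu> (Suc j) x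
      = of_nat (Suc j) * integral {0..x} (truncated_power w \<mu> j)"
proof -
  let ?H = "\<lambda>t. exp (- w * of_real t) * of_real (t - \<mu>) ^ Suc j :: complex"
  have "((\<lambda>t. if \<mu> < t then - w * (exp (- w * of_real t) * of_real (t - \<mu>) ^ Suc j)
      + of_nat (Suc j) * (exp (- w * of_real t) * of_real (t - \<mu>) ^ j) else 0) has_integral
     (if \<mu> < x then ?H x - ?H \<mu> else 0)) {0..x}" (is "(?f has_integral ?I) _")
    by (rule has_integral_truncated[OF has_vector_derivative_exp_linear_power assms])
  also have "?f = (\<lambda>t. - w * truncated_power w \<mu> (Suc j) t + of_nat (Suc j) * truncated_power w \<mu> j t)"
    by (auto simp: truncated_power_def)
  also have "?I = truncated_power w \<mu> (Suc j) x" by (simp add: truncated_power_def)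
  finally have "integral {0..x} (\<lambda>t. - w * truncated_power w \<mu> (Suc j) t + of_nat (Suc j) * truncated_power w \<mu> j t)
      = truncated_power w \<mu> (Suc j) x" by (rule integral_unique)
  moreover have "integral {0..x} (\<lambda>t. - w * truncated_power w \<mu> (Suc j) t + of_nat (Suc j) * truncated_power w \<mu> j t)
     = - w * integral {0..x} (truncated_power w \<mu> (Suc j)) + of_nat (Suc j) * integral {0..x} (truncated_power w \<mu> j)"
    using loc_integrable_mult[OF loc_integrable_truncated_power[OF assms, of w "Suc j"], of "- w"]
      loc_integrable_mult[OF loc_integrable_truncated_power[OF assms, of w j], of "of_nat (Suc j)"]
    unfolding loc_integrable_def
    by (subst integral_add) (simp_all only: integral_mult_right)
  ultimately show ?thesis by (simp add: algebra_simps)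
qed

text \<open>One factor 1 + w I lowers the exponent and leaves an integration; the remaining factors
  commute with it and meet the induction hypothesis; the integration then restores the exponent, now
  on the plain power.\<close>

lemma volterra_iter_truncated_power:
  assumes "0 \<le> \<mu>"
  shows "(volterra w ^^ Suc j) (truncated_power w \<mu> j)
    = (\<lambda>x. exp (- w * of_real \<mu>) * truncated_power 0 \<mu> j x)"
proof (induction j)
  case 0
  then show ?case using volterra_truncated_power_0[OF assms] by simp
next
  case (Suc j)
  have "volterra w (truncated_power w \<mu> (Suc j)) = (\<lambda>x. of_nat (Suc j) * integral {0..x} (truncated_power w \<mu> j))"
    unfolding volterra_def using integral_truncated_power_Suc[OF assms, of w _ j]
    by (auto simp: add.commute)
  then have "(volterra w ^^ Suc (Suc j)) (truncated_power w \<mu> (Suc j))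
     = (volterra w ^^ Suc j) (\<lambda>x. of_nat (Suc j) * integral {0..x} (truncated_power w \<mu> j))"
    by (simp only: funpow_Suc_right o_apply)
  also have "\<dots> = (\<lambda>x. of_nat (Suc j) * integral {0..x} ((volterra w ^^ Suc j) (truncated_power w \<mu> j)))"
    by (rule volterra_iter_primitive[OF loc_integrable_truncated_power[OF assms]])
  also have "\<dots> = (\<lambda>x. exp (- w * of_real \<mu>) * (of_nat (Suc j) * integral {0..x} (truncated_power 0 \<mu> j)))"
    unfolding Suc by (simp add: mult.left_commute)
  also have "\<dots> = (\<lambda>x. exp (- w * of_real \<mu>) * truncated_power 0 \<mu> (Suc j) x)"
    using integral_truncated_power_Suc[OF assms, of 0 _ j] by simp
  finally show ?case .
qed

text \<open>Half of the exponential absorbs the power, by the p-th term of the series of exp (x /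
  2), and the other half stays integrable.\<close>

lemma power_exp_bound:
  obtains K :: real where "K \<ge> 0" "\<And>x. 0 \<le> x \<Longrightarrow> x ^ p * exp (- x) \<le> K * exp (- x / 2)"
proof
  show "(2 ^ p * fact p :: real) \<ge> 0" by simp
  fix x :: real assume x: "0 \<le> x"
  have "(x / 2) ^ p / fact p \<le> exp (x / 2)"
  proof -
    have "(x / 2) ^ p / fact p = (\<Sum>n\<in>{p}. (x / 2) ^ n /\<^sub>R fact n)"
      by (simp add: field_simps)
    also have "\<dots> \<le> (\<Sum>n. (x / 2) ^ n /\<^sub>R fact n)"
      using x summable_exp_generic[of "x / 2"] by (intro sum_le_suminf) auto
    finally show ?thesis by (simp add: exp_def)
  qed
  then have "x ^ p \<le> 2 ^ p * fact p * exp (x / 2)"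
    by (simp add: power_divide divide_le_eq mult_ac)
  then have "x ^ p * exp (- x) \<le> 2 ^ p * fact p * exp (x / 2) * exp (- x)"
    by (intro mult_right_mono) auto
  also have "\<dots> = 2 ^ p * fact p * exp (- x / 2)"
    by (simp add: mult.assoc exp_add[symmetric])
  finally show "x ^ p * exp (- x) \<le> 2 ^ p * fact p * exp (- x / 2)" .
qed

text \<open>The decay of g is spent in the first application: it bounds the primitive of g by a
  constant, so only the i later applications cost a factor 1 + x. After p + 1 applications this
  leaves (1 + x)^p, exactly what division by x^p can absorb. The constant depends on p
  alone.\<close>

lemma volterra_iter_bound:
  obtains K :: real where "K \<ge> 0"
    "\<And>g M X w i x. loc_integrable g \<Longrightarrow> 0 \<le> M \<Longrightarrow>
      (\<And>x. 0 \<le> x \<Longrightarrow> x \<le> X \<Longrightarrow> cmod (g x) \<le> M * (x ^ p * exp (- x))) \<Longrightarrow> 0 \<le> x \<Longrightarrow> x \<le> X \<Longrightarrow>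
      cmod ((volterra w ^^ Suc i) g x) \<le> M * K * (1 + cmod w) ^ Suc i * (1 + x) ^ i"
proof -
  obtain K :: real where K: "K \<ge> 0" "\<And>x. 0 \<le> x \<Longrightarrow> x ^ p * exp (- x) \<le> K * exp (- x / 2)"
    using power_exp_bound[of p] by blast
  have bd: "cmod ((volterra w ^^ Suc i) g x) \<le> M * (2 * K) * (1 + cmod w) ^ Suc i * (1 + x) ^ i"
    if g: "loc_integrable g" "0 \<le> M"
      "\<And>x. 0 \<le> x \<Longrightarrow> x \<le> X \<Longrightarrow> cmod (g x) \<le> M * (x ^ p * exp (- x))" and x: "0 \<le> x" "x \<le> X"
    for g M X w i x
    using x
  proof (induction i arbitrary: x)
    case 0
    have gx: "cmod (g t) \<le> M * K * exp (- t / 2)" if "0 \<le> t" "t \<le> X" for t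
      using g(3)[OF that] mult_left_mono[OF K(2)[OF that(1)] g(2)] by (simp add: mult.assoc)
    \<comment> \<open>The majorant integrates to at most 2 M K, independently of x; this is the
      factor 2 in the final constant \<open>2 * K\<close>.\<close>
    have e: "((\<lambda>t. M * K * exp (- t / 2)) has_integral (- 2 * M * K * exp (- x / 2)) - (- 2 * M * K * exp (- 0 / 2))) {0..x}"
      using 0 by (intro fundamental_theorem_of_calculus)
        (auto intro!: derivative_eq_intros simp: has_real_derivative_iff_has_vector_derivative[symmetric])
    have "cmod (integral {0..x} g) \<le> integral {0..x} (\<lambda>t. M * K * exp (- t / 2))"
      using g(1) e 0 gx by (intro integral_norm_bound_integral) (auto simp: loc_integrable_def)
    also have "\<dots> \<le> 2 * M * K"
      using integral_unique[OF e] K(1) g(2) by simp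
    finally have I: "cmod (integral {0..x} g) \<le> 2 * M * K" .
    have "cmod (g x) \<le> M * K * exp (- x / 2)" using gx 0 by simp
    also have "\<dots> \<le> 2 * (M * K) * 1"
      using K(1) g(2) 0 mult_mono[of "M * K" "2 * (M * K)" "exp (- x / 2)" 1] by simp
    finally have "cmod (g x) \<le> 2 * M * K" by simp
    moreover have "cmod (w * integral {0..x} g) \<le> cmod w * (2 * M * K)"
      using I by (simp add: norm_mult mult_left_mono)
    ultimately have "cmod (g x + w * integral {0..x} g) \<le> 2 * M * K + cmod w * (2 * M * K)"
      by (intro order_trans[OF norm_triangle_ineq]) auto
    then show ?case by (simp add: volterra_def algebra_simps)
  next
    case (Suc i)
    let ?u = "(volterra w ^^ Suc i) g" and ?B = "M * (2 * K) * (1 + cmod w) ^ Suc i"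
    have B: "?B \<ge> 0" using K g by simp
    have "cmod (integral {0..x} ?u) \<le> integral {0..x} (\<lambda>t. ?B * (1 + x) ^ i)"
    proof (intro integral_norm_bound_integral)
      show "?u integrable_on {0..x}"
        using loc_integrable_volterra_iter[OF g(1)] unfolding loc_integrable_def by blast
      fix t assume t: "t \<in> {0..x}"
      have "cmod (?u t) \<le> ?B * (1 + t) ^ i" using Suc.IH[of t] Suc.prems t by auto
      also have "\<dots> \<le> ?B * (1 + x) ^ i"
        using B t by (intro mult_left_mono power_mono) auto
      finally show "cmod (?u t) \<le> ?B * (1 + x) ^ i" .
    qed auto
    also have "\<dots> = x * (?B * (1 + x) ^ i)" using Suc.prems by simp
    finally have I: "cmod (w * integral {0..x} ?u) \<le> cmod w * (x * (?B * (1 + x) ^ i))"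
      unfolding norm_mult by (intro mult_left_mono) auto
    have "cmod ((volterra w ^^ Suc (Suc i)) g x) = cmod (?u x + w * integral {0..x} ?u)"
      by (simp add: volterra_def)
    also have "\<dots> \<le> ?B * (1 + x) ^ i + cmod w * (x * (?B * (1 + x) ^ i))"
      using I Suc by (intro order_trans[OF norm_triangle_ineq] add_mono) auto
    also have "\<dots> = (?B * (1 + x) ^ i) * (1 + cmod w * x)" by (simp add: algebra_simps)
    also have "\<dots> \<le> (?B * (1 + x) ^ i) * ((1 + cmod w) * (1 + x))"
    proof (rule mult_left_mono)
      show "1 + cmod w * x \<le> (1 + cmod w) * (1 + x)" using Suc.prems by (simp add: algebra_simps)
      show "0 \<le> ?B * (1 + x) ^ i" using Suc.prems by (intro mult_nonneg_nonneg[OF B] zero_le_power) auto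
    qed
    also have "\<dots> = M * (2 * K) * (1 + cmod w) ^ Suc (Suc i) * (1 + x) ^ Suc i"
      by (simp add: mult_ac)
    finally show ?case .
  qed
  show ?thesis
  proof (rule that[of "2 * K"])
    show "2 * K \<ge> 0" using K by simp
  qed (rule bd)
qed

lemma riesz_mean_nat:
  assumes "0 < x"
  shows "riesz_mean lam a (real p) x s =
    (\<Sum>n | lam n < x. a n * exp (- complex_of_real (lam n) * s) * of_real (x - lam n) ^ p) / of_real x ^ p"
proof -
  have "(1 - lam n / x) powr real p = (x - lam n) ^ p / x ^ p" if "lam n < x" for n
    using that assms by (simp add: powr_realpow power_divide[symmetric] diff_divide_distrib)
  then show ?thesis
    unfolding riesz_mean_def sum_divide_distrib by (intro sum.cong) auto
qed

text \<open>The terms of the mean at s, multiplied by exp (-t w), form a function to which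
  \<open>volterra_iter_truncated_power\<close> applies, and \<open>Re w = 1\<close> gives it the
  decay exp (-t). Thus bounds at the single point s control the whole line one unit to its right, at
  the price of (1 + |w|)^(p+1).\<close>

lemma riesz_mean_vertical_bound:
  obtains K :: real where "K \<ge> 0"
    "\<And>lam a s M w x. frequency lam \<Longrightarrow>
       (\<And>x. 0 < x \<Longrightarrow> cmod (riesz_mean lam a (real p) x s) \<le> M) \<Longrightarrow> Re w = 1 \<Longrightarrow> 1 \<le> x \<Longrightarrow>
       cmod (riesz_mean lam a (real p) x (s + w)) \<le> M * K * (1 + cmod w) ^ Suc p"
proof -
  obtain K :: real where K: "K \<ge> 0"
    "\<And>g M X w i x. loc_integrable g \<Longrightarrow> 0 \<le> M \<Longrightarrow>
      (\<And>x. 0 \<le> x \<Longrightarrow> x \<le> X \<Longrightarrow> cmod (g x) \<le> M * (x ^ p * exp (- x))) \<Longrightarrow> 0 \<le> x \<Longrightarrow> x \<le> X \<Longrightarrow>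
      cmod ((volterra w ^^ Suc i) g x) \<le> M * K * (1 + cmod w) ^ Suc i * (1 + x) ^ i"
    using volterra_iter_bound[of p] by blast
  have "cmod (riesz_mean lam a (real p) x (s + w)) \<le> M * (K * 2 ^ p) * (1 + cmod w) ^ Suc p"
    if fr: "frequency lam" and bd: "\<And>x. 0 < x \<Longrightarrow> cmod (riesz_mean lam a (real p) x s) \<le> M"
      and w: "Re w = 1" and x: "1 \<le> x" for lam a s M w x
  proof -
    let ?A = "{n. lam n < x}"
    define b where "b n = a n * exp (- complex_of_real (lam n) * s)" for n
    \<comment> \<open>The index set is frozen at the final x to make g a fixed finite combination.
      For t <= x the terms with lam n >= t vanish, so g t still involves only the Riesz mean at
      t.\<close>
    define g where "g t = (\<Sum>n\<in>?A. b n * truncated_power w (lam n) p t)" for t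
    have fin: "finite ?A" by (rule frequency_finite_less[OF fr])
    have M: "M \<ge> 0" using order_trans[OF norm_ge_zero bd[of 1]] by simp
    have loc: "loc_integrable (truncated_power w (lam n) p)" for n
      by (rule loc_integrable_truncated_power[OF frequency_nonneg[OF fr]])
    have "loc_integrable g"
      unfolding g_def by (intro loc_integrable_sum loc_integrable_mult loc fin)
    moreover have "cmod (g t) \<le> M * (t ^ p * exp (- t))" if t: "0 \<le> t" "t \<le> x" for t
    proof (cases "t = 0")
      case True
      then show ?thesis using M frequency_nonneg[OF fr]
        by (simp add: g_def truncated_power_def not_less[symmetric]) (simp add: not_less)
    next
      case False
      then have "0 < t" using t by simp
      have "g t = (\<Sum>n | lam n < t. b n * truncated_power w (lam n) p t)"
        unfolding g_def using t fin by (intro sum.mono_neutral_right) (auto simp: truncated_power_def)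
      also have "\<dots> = exp (- w * of_real t) * (\<Sum>n | lam n < t. b n * of_real (t - lam n) ^ p)"
        unfolding sum_distrib_left by (intro sum.cong) (auto simp: truncated_power_def)
      also have "(\<Sum>n | lam n < t. b n * of_real (t - lam n) ^ p) = of_real t ^ p * riesz_mean lam a (real p) t s"
        using \<open>0 < t\<close> by (simp add: riesz_mean_nat b_def)
      finally have "cmod (g t) = exp (- t) * (t ^ p * cmod (riesz_mean lam a (real p) t s))"
        using w t by (simp add: norm_mult norm_power)
      also have "\<dots> \<le> exp (- t) * (t ^ p * M)"
        using t by (intro mult_left_mono bd \<open>0 < t\<close>) auto
      finally show ?thesis by (simp add: mult_ac)
    qed
    ultimately have "cmod ((volterra w ^^ Suc p) g x) \<le> M * K * (1 + cmod w) ^ Suc p * (1 + x) ^ p"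
      using M x by (intro K(2)[where X = x]) auto
    also have "(volterra w ^^ Suc p) g x = (\<Sum>n\<in>?A. b n * (exp (- w * of_real (lam n)) * truncated_power 0 (lam n) p x))"
      unfolding g_def volterra_iter_sum[OF fin loc] volterra_iter_truncated_power[OF frequency_nonneg[OF fr]] ..
    also have "\<dots> = of_real x ^ p * riesz_mean lam a (real p) x (s + w)"
      using x by (simp add: riesz_mean_nat) (intro sum.cong, auto simp: b_def truncated_power_def exp_diff exp_minus field_simps exp_add)
    finally have "x ^ p * cmod (riesz_mean lam a (real p) x (s + w)) \<le> M * K * (1 + cmod w) ^ Suc p * (1 + x) ^ p"
      using x by (simp add: norm_mult norm_power)
    \<comment> \<open>Since x >= 1, 1 + x is at most 2 x; this accounts for the factor
      \<open>2 ^ p\<close> in the constant.\<close>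
    also have "\<dots> \<le> M * K * (1 + cmod w) ^ Suc p * (2 * x) ^ p"
      using x M K(1) by (intro mult_left_mono power_mono) auto
    also have "\<dots> = x ^ p * (M * (K * 2 ^ p) * (1 + cmod w) ^ Suc p)"
      by (simp add: power_mult_distrib mult_ac)
    finally show ?thesis using x by (simp add: mult_le_cancel_left_pos)
  qed
  then show ?thesis using that[of "K * 2 ^ p"] K(1) by auto
qed

subsection \<open>Perron's formula for Riesz germs\<close>

text \<open>The Riesz means of order p are finite sums, for which the formula is
  \<open>perron_kernel\<close> term by term. They converge to f on the line, and K >= p + 2 makes
  the kernel beat their growth (1 + |w|)^(p+1), so dominated convergence passes the formula to
  f.\<close>

lemma riesz_germ_perron:
  assumes fr: "frequency lam" and germ: "riesz_germ lam a f"
  obtains \<sigma> K0 where "\<sigma> \<ge> 0" "K0 \<ge> 1"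
    "\<And>K s c x. K \<ge> K0 \<Longrightarrow> 0 < Re s \<Longrightarrow> \<sigma> + 1 \<le> c \<Longrightarrow>
      (CLBINT t. f (s + Complex c t) * (exp (of_real x * Complex c t) / Complex c t ^ Suc K)) =
      2 * pi / fact K * (\<Sum>n | lam n < x. a n * exp (- complex_of_real (lam n) * s) * of_real (x - lam n) ^ K)"
proof -
  obtain m \<sigma> where m: "m \<ge> 0" and \<sigma>: "\<sigma> \<ge> 0"
    and conv: "\<And>s. \<sigma> < Re s \<Longrightarrow> ((\<lambda>x. riesz_mean lam a m x s) \<longlongrightarrow> f s) at_top"
    and hol: "f holomorphic_on {s. 0 < Re s}"
    using germ by (auto simp: riesz_germ_def right_half_plane_def)
  \<comment> \<open>The added 1 keeps q positive when m is an integer, as the Beta integral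
    demands.\<close>
  define p where "p = nat \<lceil>m\<rceil> + 1"
  define q where "q = real p - m"
  have q: "q > 0" "m + q = real p" using m by (auto simp: p_def q_def) linarith
  have conv_p: "((\<lambda>x. riesz_mean lam a (real p) x s) \<longlongrightarrow> f s) at_top" if "\<sigma> < Re s" for s
    using riesz_mean_raise_order_tendsto[OF fr m q(1) conv[OF that]] q by simp
  obtain B :: real where B: "B \<ge> 0"
    "\<And>lam a s M w x. frequency lam \<Longrightarrow>
       (\<And>x. 0 < x \<Longrightarrow> cmod (riesz_mean lam a (real p) x s) \<le> M) \<Longrightarrow> Re w = 1 \<Longrightarrow> 1 \<le> x \<Longrightarrow>
       cmod (riesz_mean lam a (real p) x (s + w)) \<le> M * B * (1 + cmod w) ^ Suc p"
    using riesz_mean_vertical_bound[of p] by blast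
  have "(CLBINT t. f (s + Complex c t) * (exp (of_real x * Complex c t) / Complex c t ^ Suc K)) =
      2 * pi / fact K * (\<Sum>n | lam n < x. a n * exp (- complex_of_real (lam n) * s) * of_real (x - lam n) ^ K)"
    if K: "K \<ge> p + 2" and s: "0 < Re s" and c: "\<sigma> + 1 \<le> c" for K s c x
  proof -
    \<comment> \<open>The means converge, hence are bounded, at s0, and the line of integration lies
      one unit to the right of s0. This is why c must be at least
      \<open>\<sigma> + 1\<close>.\<close>
    define s0 where "s0 = s + of_real (c - 1)"
    have c1: "c \<ge> 1" "c > 0" using c \<sigma> by auto
    have s0: "\<sigma> < Re s0" using s c by (simp add: s0_def)
    have s0w: "s0 + Complex 1 t = s + Complex c t" for t by (simp add: s0_def complex_eq_iff)
    obtain M where M: "\<And>x. 0 < x \<Longrightarrow> cmod (riesz_mean lam a (real p) x s0) \<le> M"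
      using convergent_riesz_mean_bounded[OF fr _ conv_p[OF s0]] by auto
    have M0: "M \<ge> 0" using order_trans[OF norm_ge_zero M[of 1]] by simp
    let ?k = "\<lambda>t. exp (of_real x * Complex c t) / Complex c t ^ Suc K"
    define g where "g n t = riesz_mean lam a (real p) (real (Suc n)) (s + Complex c t) * ?k t" for n t
    define D where "D = M * B * 2 ^ Suc p * exp (x * c)"
    have gbound: "cmod (g n t) \<le> D * (1 / (c\<^sup>2 + t\<^sup>2))" for n t
    proof -
      let ?w = "cmod (Complex c t)"
      have w1: "1 \<le> ?w" using abs_Re_le_cmod[of "Complex c t"] c1 by simp
      have "cmod (Complex 1 t) \<le> ?w" unfolding cmod_def using c1 by (auto intro!: power_mono)
      then have le: "1 + cmod (Complex 1 t) \<le> 2 * ?w" using w1 by simp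
      have "cmod (riesz_mean lam a (real p) (real (Suc n)) (s0 + Complex 1 t))
          \<le> M * B * (1 + cmod (Complex 1 t)) ^ Suc p"
        using M by (intro B(2)[OF fr]) auto
      also have "\<dots> \<le> M * B * (2 * ?w) ^ Suc p"
        using le M0 B(1) by (intro mult_left_mono power_mono) auto
      finally have 1: "cmod (riesz_mean lam a (real p) (real (Suc n)) (s + Complex c t))
         \<le> M * B * 2 ^ Suc p * ?w ^ Suc p"
        by (simp only: s0w power_mult_distrib mult.assoc)
      have "?w ^ Suc p * ?w\<^sup>2 = ?w ^ (p + 3)" by (simp add: power_add eval_nat_numeral)
      also have "\<dots> \<le> ?w ^ Suc K"
        using w1 K by (intro power_increasing) auto
      finally have "?w ^ Suc p * ?w\<^sup>2 \<le> ?w ^ Suc K" .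
      moreover have "0 < ?w ^ Suc K" "0 < ?w\<^sup>2" using w1 by (intro zero_less_power, linarith)+
      ultimately have 2: "?w ^ Suc p / ?w ^ Suc K \<le> 1 / ?w\<^sup>2"
        by (metis divide_right_mono le_divide_eq_1_pos mult.commute pos_divide_le_eq pos_le_divide_eq mult_1 times_divide_eq_left)
      have "cmod (g n t) = cmod (riesz_mean lam a (real p) (real (Suc n)) (s + Complex c t)) * (exp (x * c) / ?w ^ Suc K)"
        by (simp add: g_def norm_mult norm_divide norm_power)
      also have "\<dots> \<le> (M * B * 2 ^ Suc p * ?w ^ Suc p) * (exp (x * c) / ?w ^ Suc K)"
        using 1 by (intro mult_right_mono) auto
      also have "\<dots> = D * (?w ^ Suc p / ?w ^ Suc K)" by (simp add: D_def)
      also have "\<dots> \<le> D * (1 / ?w\<^sup>2)"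
        using 2 M0 B(1) by (intro mult_left_mono) (auto simp: D_def)
      finally show ?thesis by (simp add: cmod_power2)
    qed
    have Ccont: "continuous_on UNIV (\<lambda>t. Complex c t)"
      unfolding Complex_eq by (intro continuous_intros)
    have Cnz: "Complex c t \<noteq> 0" for t using c1 by (simp add: complex_eq_iff)
    have kcont: "continuous_on UNIV ?k"
      by (intro continuous_on_divide continuous_on_exp continuous_on_mult continuous_on_power
        continuous_on_const Ccont) (use Cnz in \<open>simp del: power_Suc\<close>)
    have fcont: "continuous_on UNIV (\<lambda>t. f (s + Complex c t))"
      unfolding Complex_eq using c1 s
      by (intro continuous_on_compose2[OF holomorphic_on_imp_continuous_on[OF hol]] continuous_intros) auto
    have gcont: "continuous_on UNIV (g n)" for n
      unfolding g_def riesz_mean_def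
      by (intro continuous_on_mult continuous_on_sum continuous_on_exp continuous_on_add continuous_on_const
        Ccont kcont)
    have lim: "(\<lambda>n. CLBINT t. g n t) \<longlonglongrightarrow> (CLBINT t. f (s + Complex c t) * ?k t)"
    proof (rule integral_dominated_convergence[where w = "\<lambda>t. D * (1 / (c\<^sup>2 + t\<^sup>2))"])
      show "(\<lambda>t. f (s + Complex c t) * ?k t) \<in> borel_measurable lborel"
        using continuous_on_mult[OF fcont kcont] by (simp add: borel_measurable_continuous_onI)
      show "g n \<in> borel_measurable lborel" for n
        using gcont by (simp add: borel_measurable_continuous_onI)
      show "integrable lborel (\<lambda>t. D * (1 / (c\<^sup>2 + t\<^sup>2)))"
        by (intro integrable_mult_right inverse_sum_squares_integral c1)
      show "AE t in lborel. cmod (g n t) \<le> D * (1 / (c\<^sup>2 + t\<^sup>2))" for n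
        using gbound by (intro AE_I2)
      show "AE t in lborel. (\<lambda>n. g n t) \<longlonglongrightarrow> f (s + Complex c t) * ?k t"
      proof (intro AE_I2)
        fix t
        have "((\<lambda>x. riesz_mean lam a (real p) x (s + Complex c t)) \<longlongrightarrow> f (s + Complex c t)) at_top"
          using s c by (intro conv_p) auto
        moreover have "filterlim (\<lambda>n. real (Suc n)) at_top sequentially"
          by (rule filterlim_compose[OF filterlim_real_sequentially filterlim_Suc])
        ultimately have "(\<lambda>n. riesz_mean lam a (real p) (real (Suc n)) (s + Complex c t)) \<longlonglongrightarrow> f (s + Complex c t)"
          by (rule filterlim_compose)
        then show "(\<lambda>n. g n t) \<longlonglongrightarrow> f (s + Complex c t) * ?k t"
          unfolding g_def by (intro tendsto_mult tendsto_const)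
      qed
    qed
    define T where "T j = a j * exp (- complex_of_real (lam j) * s)" for j
    have int: "(CLBINT t. g n t) = 2 * pi / fact K *
        (\<Sum>j | lam j < x. T j * of_real (x - lam j) ^ K * of_real ((1 - lam j / real (Suc n)) powr real p))"
      if n: "x \<le> real (Suc n)" for n
    proof -
      let ?r = "\<lambda>j. complex_of_real ((1 - lam j / real (Suc n)) powr real p)"
      have "exp (- complex_of_real (lam j) * (s + Complex c t)) * exp (of_real x * Complex c t)
          = exp (- complex_of_real (lam j) * s) * exp (of_real (x - lam j) * Complex c t)" for j t
        unfolding exp_add[symmetric] by (simp add: algebra_simps)
      then have "g n t = (\<Sum>j | lam j < real (Suc n). (T j * ?r j) *
          (exp (of_real (x - lam j) * Complex c t) / Complex c t ^ Suc K))" for t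
        unfolding g_def riesz_mean_def T_def sum_distrib_right
        by (intro sum.cong refl) (simp add: mult_ac)
      then have "(CLBINT t. g n t) = (CLBINT t. (\<Sum>j | lam j < real (Suc n). (T j * ?r j) *
          (exp (of_real (x - lam j) * Complex c t) / Complex c t ^ Suc K)))"
        by simp
      also have "\<dots> = (\<Sum>j | lam j < real (Suc n). (T j * ?r j) *
          (CLBINT t. exp (of_real (x - lam j) * Complex c t) / Complex c t ^ Suc K))"
      proof (subst Bochner_Integration.integral_sum)
        fix j
        show "complex_integrable lborel (\<lambda>t. (T j * ?r j) * (exp (of_real (x - lam j) * Complex c t) / Complex c t ^ Suc K))"
          using K by (intro integrable_mult_right perron_kernel_integrable c1) auto
      qed (intro sum.cong refl integral_mult_right_zero)
      also have "\<dots> = (\<Sum>j | lam j < real (Suc n). (T j * ?r j) * (2 * pi / fact K * of_real (max 0 (x - lam j) ^ K)))"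
        using K c1 by (subst perron_kernel) auto
      \<comment> \<open>For n large the terms with lam j >= x vanish by \<open>max 0\<close>. The
        index set no longer depends on n, so the limit can be taken term by term.\<close>
      also have "\<dots> = (\<Sum>j | lam j < x. (T j * ?r j) * (2 * pi / fact K * of_real (max 0 (x - lam j) ^ K)))"
        using n K by (intro sum.mono_neutral_right frequency_finite_less[OF fr]) (auto simp: max_def)
      also have "\<dots> = 2 * pi / fact K * (\<Sum>j | lam j < x. T j * of_real (x - lam j) ^ K * ?r j)"
        unfolding sum_distrib_left by (intro sum.cong refl) (auto simp: max_def)
      finally show ?thesis .
    qed
    have "(\<lambda>n. 2 * pi / fact K *
        (\<Sum>j | lam j < x. T j * of_real (x - lam j) ^ K * of_real ((1 - lam j / real (Suc n)) powr real p)))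
        \<longlonglongrightarrow> 2 * pi / fact K * (\<Sum>j | lam j < x. T j * of_real (x - lam j) ^ K * of_real 1)"
    proof (intro tendsto_mult tendsto_sum tendsto_const tendsto_of_real)
      fix j
      have "(\<lambda>n. 1 - lam j / real (Suc n)) \<longlonglongrightarrow> 1" by real_asymp
      from tendsto_powr[OF this tendsto_const, of "real p"]
      show "(\<lambda>n. (1 - lam j / real (Suc n)) powr real p) \<longlonglongrightarrow> 1" by simp
    qed
    moreover have "\<forall>\<^sub>F n in sequentially. 2 * pi / fact K *
        (\<Sum>j | lam j < x. T j * of_real (x - lam j) ^ K * of_real ((1 - lam j / real (Suc n)) powr real p))
        = (CLBINT t. g n t)"
    proof -
      obtain N :: nat where "x \<le> real N" using real_arch_simple by blast
      then show ?thesis by (intro eventually_sequentiallyI[of N] int[symmetric]) auto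
    qed
    ultimately have "(\<lambda>n. CLBINT t. g n t) \<longlonglongrightarrow> 2 * pi / fact K * (\<Sum>j | lam j < x. T j * of_real (x - lam j) ^ K * of_real 1)"
      by (rule Lim_transform_eventually)
    with lim have "(CLBINT t. f (s + Complex c t) * ?k t)
        = 2 * pi / fact K * (\<Sum>j | lam j < x. T j * of_real (x - lam j) ^ K * of_real 1)"
      by (rule LIMSEQ_unique)
    then show ?thesis by (simp only: T_def of_real_1 mult_1_right)
  qed
  then show ?thesis using that[of \<sigma> "p + 2"] \<sigma> by auto
qed

section \<open>Uniqueness of the Bohr coefficients\<close>

text \<open>Perron's formula at an order and an abscissa admissible for both germs recovers the
  weighted sums from f alone, so the two germs have equal sums for every x.\<close>

lemma riesz_germ_unique:
  assumes fr: "frequency lam" and "riesz_germ lam a f" "riesz_germ lam b f"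
  shows "a = b"
proof -
  obtain \<sigma> K0 where A: "\<sigma> \<ge> 0" "K0 \<ge> 1"
    "\<And>K s c x. K \<ge> K0 \<Longrightarrow> 0 < Re s \<Longrightarrow> \<sigma> + 1 \<le> c \<Longrightarrow>
      (CLBINT t. f (s + Complex c t) * (exp (of_real x * Complex c t) / Complex c t ^ Suc K)) =
      2 * pi / fact K * (\<Sum>n | lam n < x. a n * exp (- complex_of_real (lam n) * s) * of_real (x - lam n) ^ K)"
    using riesz_germ_perron[OF assms(1,2)] by blast
  obtain \<tau> K1 where B: "\<tau> \<ge> 0" "K1 \<ge> 1"
    "\<And>K s c x. K \<ge> K1 \<Longrightarrow> 0 < Re s \<Longrightarrow> \<tau> + 1 \<le> c \<Longrightarrow>
      (CLBINT t. f (s + Complex c t) * (exp (of_real x * Complex c t) / Complex c t ^ Suc K)) =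
      2 * pi / fact K * (\<Sum>n | lam n < x. b n * exp (- complex_of_real (lam n) * s) * of_real (x - lam n) ^ K)"
    using riesz_germ_perron[OF assms(1,3)] by blast
  define K where "K = max K0 K1"
  define d where "d n = (a n - b n) * exp (- complex_of_real (lam n) * 1)" for n
  have eq: "(\<Sum>n | lam n < x. d n * of_real (x - lam n) ^ K) = 0" for x
  proof -
    let ?c = "max \<sigma> \<tau> + 1"
    have "2 * pi / fact K * (\<Sum>n | lam n < x. a n * exp (- complex_of_real (lam n) * 1) * of_real (x - lam n) ^ K)
      = 2 * pi / fact K * (\<Sum>n | lam n < x. b n * exp (- complex_of_real (lam n) * 1) * of_real (x - lam n) ^ K)"
      using A(3)[of K 1 ?c x] B(3)[of K 1 ?c x] by (simp add: K_def)
    then have "(\<Sum>n | lam n < x. a n * exp (- complex_of_real (lam n) * 1) * of_real (x - lam n) ^ K)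
      = (\<Sum>n | lam n < x. b n * exp (- complex_of_real (lam n) * 1) * of_real (x - lam n) ^ K)"
      by simp
    then show ?thesis by (simp add: d_def left_diff_distrib sum_subtractf)
  qed
  have "d n = 0" for n
  proof (induction n rule: less_induct)
    case (less n)
    \<comment> \<open>At x = lam (n + 1) only the indices up to n occur, and the earlier ones vanish
      by induction: the system is triangular with nonzero diagonal.\<close>
    have "{j. lam j < lam (Suc n)} = insert n {..<n}"
      using frequency_less_iff[OF fr] by auto
    then have "d n * of_real (lam (Suc n) - lam n) ^ K = 0"
      using eq[of "lam (Suc n)"] less by simp
    moreover have "lam (Suc n) \<noteq> lam n" using frequency_less_iff[OF fr, of n "Suc n"] by auto
    ultimately show ?case by simp
  qed
  then show ?thesis by (auto simp: d_def)
qed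

lemma bohr_coeff_eq:
  assumes "frequency lam" "riesz_germ lam a f"
  shows "bohr_coeff lam f = a"
  unfolding bohr_coeff_def using assms riesz_germ_unique by blast

section \<open>Lowering the order of Perron's formula\<close>

text \<open>The exponent is at least 2, so the kink at y = 0 causes no trouble. Only steps to the
  right are taken, so y >= 0 reduces to the plain power, while for y < 0 the quotient is eventually
  0.\<close>

lemma max_0_power_right_difference_quotient:
  "(\<lambda>n. (max 0 (y + 1 / real (Suc n)) ^ Suc (Suc K) - max 0 y ^ Suc (Suc K)) / (1 / real (Suc n)))
    \<longlonglongrightarrow> real (Suc (Suc K)) * max 0 y ^ Suc K"
proof (cases "y < 0")
  case True
  have "(\<lambda>n. y + 1 / real (Suc n)) \<longlonglongrightarrow> y" by real_asymp
  then have "eventually (\<lambda>n. y + 1 / real (Suc n) < 0) sequentially"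
    using True by (rule order_tendstoD)
  then have "eventually (\<lambda>n. (max 0 (y + 1 / real (Suc n)) ^ Suc (Suc K) - max 0 y ^ Suc (Suc K)) / (1 / real (Suc n))
    = real (Suc (Suc K)) * max 0 y ^ Suc K) sequentially"
    by eventually_elim (use True in \<open>simp add: max_def\<close>)
  then show ?thesis by (rule tendsto_eventually)
next
  case False
  have "((\<lambda>y. y ^ Suc (Suc K)) has_real_derivative real (Suc (Suc K)) * y ^ Suc K) (at y)"
    using DERIV_pow[of "Suc (Suc K)" y] by (simp only: diff_Suc_Suc minus_nat.diff_0)
  then have "((\<lambda>h. ((y + h) ^ Suc (Suc K) - y ^ Suc (Suc K)) / h) \<longlongrightarrow> real (Suc (Suc K)) * y ^ Suc K) (at 0)"
    by (simp only: DERIV_def)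
  moreover have "filterlim (\<lambda>n. 1 / real (Suc n)) (at 0) sequentially"
    by (rule filterlim_atI) (real_asymp, simp)
  ultimately have "(\<lambda>n. ((y + 1 / real (Suc n)) ^ Suc (Suc K) - y ^ Suc (Suc K)) / (1 / real (Suc n)))
    \<longlonglongrightarrow> real (Suc (Suc K)) * y ^ Suc K"
    by (rule filterlim_compose)
  moreover have "max 0 (y + 1 / real (Suc n)) = y + 1 / real (Suc n)" for n
    using False by (simp add: add_nonneg_nonneg)
  ultimately show ?thesis using False by (simp only: max.absorb2 not_less)
qed

lemma norm_exp_minus_1_le:
  assumes "0 \<le> Re z" "Re z \<le> c"
  shows "cmod (exp z - 1) \<le> exp c * cmod z"
proof -
  have "cmod (exp z - exp 0) \<le> exp c * cmod (z - 0)"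
  proof (rule field_differentiable_bound[where S = "{z. 0 \<le> Re z \<and> Re z \<le> c}"])
    show "convex {z. 0 \<le> Re z \<and> Re z \<le> c}"
      using convex_Int[OF convex_halfspace_Re_ge[of 0] convex_halfspace_Re_le[of c]]
      by (simp add: Collect_conj_eq)
    show "(exp has_field_derivative exp w) (at w within {z. 0 \<le> Re z \<and> Re z \<le> c})" for w
      by (auto intro!: derivative_eq_intros)
  qed (use assms in auto)
  then show ?thesis by simp
qed

text \<open>Two estimates combine: 1 + |s + w| <= (1 + |s|) (1 + |w|), and 1 + |w| <= (1 + 1/c) |w|
  because |w| >= c. What remains is |w|^(l+1-k) / |w|^2, whose first exponent is not positive, so
  |w| can be replaced by c there.\<close>

lemma powr_growth_bound:
  fixes c l C :: real
  assumes growth: "\<And>s. 0 < Re s \<Longrightarrow> cmod (f s) \<le> C * (1 + cmod s) powr l"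
    and "0 \<le> l" "l + 1 \<le> real k" "0 < c" "0 < Re s" "c \<le> Re w"
  shows "cmod (f (s + w) / w ^ Suc k)
    \<le> C * (1 + cmod s) powr l * (1 + 1 / c) powr l * c powr (l + 1 - real k) / (cmod w)\<^sup>2"
proof -
  let ?W = "cmod w"
  have W: "c \<le> ?W" using assms complex_Re_le_cmod[of w] by linarith
  then have W0: "0 < ?W" using assms by linarith
  have C0: "0 \<le> C"
    using order_trans[OF norm_ge_zero growth[of 1]] by (simp add: zero_le_mult_iff)
  have "1 + cmod (s + w) \<le> (1 + cmod s) * (1 + ?W)"
  proof -
    have "(1 + cmod s) * (1 + ?W) = 1 + cmod s + ?W + cmod s * ?W" by (simp add: algebra_simps)
    moreover have "0 \<le> cmod s * ?W" by (intro mult_nonneg_nonneg) auto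
    ultimately show ?thesis using norm_triangle_ineq[of s w] by linarith
  qed
  also have "\<dots> \<le> (1 + cmod s) * ((1 + 1 / c) * ?W)"
    using W assms by (intro mult_left_mono) (auto simp: field_simps)
  finally have "(1 + cmod (s + w)) powr l \<le> ((1 + cmod s) * ((1 + 1 / c) * ?W)) powr l"
    using assms by (intro powr_mono2) auto
  also have "\<dots> = (1 + cmod s) powr l * (1 + 1 / c) powr l * ?W powr l"
    using assms by (simp add: powr_mult)
  finally have 1: "(1 + cmod (s + w)) powr l \<le> (1 + cmod s) powr l * (1 + 1 / c) powr l * ?W powr l" .
  have "?W powr l / ?W ^ Suc k = ?W powr (l + 1 - real k) / ?W\<^sup>2"
  proof -
    have "?W powr l / ?W ^ Suc k = ?W powr l / ?W powr real (Suc k)"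
      using W0 by (simp only: powr_realpow)
    also have "\<dots> = ?W powr (l - real (Suc k))" by (simp only: powr_diff)
    also have "\<dots> = ?W powr ((l + 1 - real k) - 2)" by (intro arg_cong2[where f = "(powr)"]) auto
    also have "\<dots> = ?W powr (l + 1 - real k) / ?W powr real 2" by (simp only: powr_diff of_nat_numeral)
    finally show ?thesis using W0 by (simp only: powr_realpow)
  qed
  also have "\<dots> \<le> c powr (l + 1 - real k) / ?W\<^sup>2"
    using W assms by (intro divide_right_mono powr_mono2') auto
  finally have 2: "?W powr l / ?W ^ Suc k \<le> c powr (l + 1 - real k) / ?W\<^sup>2" .
  have "cmod (f (s + w) / w ^ Suc k) \<le> C * (1 + cmod (s + w)) powr l / ?W ^ Suc k"
    unfolding norm_divide norm_power using growth[of "s + w"] assms by (intro divide_right_mono) auto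
  also have "\<dots> \<le> C * ((1 + cmod s) powr l * (1 + 1 / c) powr l * ?W powr l) / ?W ^ Suc k"
    using 1 C0 by (intro divide_right_mono mult_left_mono) auto
  also have "\<dots> = C * ((1 + cmod s) powr l * (1 + 1 / c) powr l) * (?W powr l / ?W ^ Suc k)"
    by simp
  also have "\<dots> \<le> C * ((1 + cmod s) powr l * (1 + 1 / c) powr l) * (c powr (l + 1 - real k) / ?W\<^sup>2)"
    using 2 C0 by (intro mult_left_mono) auto
  finally show ?thesis by (simp add: mult.assoc)
qed

text \<open>\<open>C\<close> is any admissible constant rather than the norm itself, so that one
  \<open>C\<close> can serve all members of a bounded sequence.\<close>

locale growth_function =
  fixes f :: "complex \<Rightarrow> complex" and C l :: real
  assumes hol: "f holomorphic_on {s. 0 < Re s}"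
    and growth: "\<And>s. 0 < Re s \<Longrightarrow> cmod (f s) \<le> C * (1 + cmod s) powr l"
    and l: "0 \<le> l"
begin

lemma C_nonneg: "0 \<le> C"
  using order_trans[OF norm_ge_zero growth[of 1]] by (simp add: zero_le_mult_iff)

definition integrand :: "nat \<Rightarrow> complex \<Rightarrow> real \<Rightarrow> complex \<Rightarrow> complex" where
  "integrand k s x w = f (s + w) * (exp (of_real x * w) / w ^ Suc k)"

lemma integrand_holomorphic: "0 < Re s \<Longrightarrow> integrand k s x holomorphic_on {w. 0 < Re w}"
  unfolding integrand_def
  by (intro holomorphic_intros holomorphic_on_compose_gen[OF _ hol, unfolded o_def]) auto

lemma integrand_bound:
  assumes "l + 1 \<le> real k" "0 < c" "0 < Re s" "c \<le> Re w" "Re w \<le> c'"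
  shows "cmod (integrand k s x w)
    \<le> exp (\<bar>x\<bar> * c') * (C * (1 + cmod s) powr l * (1 + 1 / c) powr l * c powr (l + 1 - real k)) / (cmod w)\<^sup>2"
proof -
  have "x * Re w \<le> \<bar>x\<bar> * c'" using assms by (intro mult_mono) auto
  then have "cmod (exp (of_real x * w)) * cmod (f (s + w) / w ^ Suc k) \<le> exp (\<bar>x\<bar> * c') *
      (C * (1 + cmod s) powr l * (1 + 1 / c) powr l * c powr (l + 1 - real k) / (cmod w)\<^sup>2)"
    using powr_growth_bound[OF growth l assms(1-4)] by (intro mult_mono) auto
  then have ineq: "cmod (exp (of_real x * w)) * cmod (f (s + w) / w ^ Suc k) \<le>
      exp (\<bar>x\<bar> * c') * (C * (1 + cmod s) powr l * (1 + 1 / c) powr l * c powr (l + 1 - real k)) / (cmod w)\<^sup>2"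
    by (simp only: times_divide_eq_right)
  have eq: "integrand k s x w = exp (of_real x * w) * (f (s + w) / w ^ Suc k)"
    by (simp add: integrand_def)
  show ?thesis unfolding eq norm_mult by (rule ineq)
qed

lemma integrand_integrable:
  assumes "l + 1 \<le> real k" "0 < c" "0 < Re s"
  shows "integrable lborel (\<lambda>t. integrand k s x (Complex c t))"
proof (rule vertical_integrable)
  show "continuous_on {w. 0 < Re w} (integrand k s x)"
    by (intro holomorphic_on_imp_continuous_on integrand_holomorphic assms)
  show "cmod (integrand k s x (Complex c t)) \<le>
    exp (\<bar>x\<bar> * c) * (C * (1 + cmod s) powr l * (1 + 1 / c) powr l * c powr (l + 1 - real k)) / (c\<^sup>2 + t\<^sup>2)" for t
    using integrand_bound[OF assms, of "Complex c t" c x] by (simp add: cmod_power2)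
qed (rule assms)

lemma integrand_shift:
  assumes "l + 1 \<le> real k" "0 < c" "c < c'" "0 < Re s"
  shows "(CLBINT t. integrand k s x (Complex c t)) = (CLBINT t. integrand k s x (Complex c' t))"
  using assms
  by (intro vertical_integral_shift[OF integrand_holomorphic _ _ integrand_bound[of k c s _ c']] integrand_integrable) auto

text \<open>Differentiating exp (x w) / w^(k+2) in x gives exp (x w) / w^(k+1). The growth bound
  already makes the integrand of order k integrable, and the quotients are dominated by exp c times
  it because the steps are at most 1.\<close>

lemma integrand_difference_quotient_tendsto:
  assumes "l + 1 \<le> real k" "0 < c" "0 < Re s"
  shows "(\<lambda>n. ((CLBINT t. integrand (Suc k) s (x + 1 / real (Suc n)) (Complex c t))
      - (CLBINT t. integrand (Suc k) s x (Complex c t))) / of_real (1 / real (Suc n)))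
    \<longlonglongrightarrow> (CLBINT t. integrand k s x (Complex c t))"
proof -
  define h :: "nat \<Rightarrow> real" where "h = (\<lambda>n. 1 / real (Suc n))"
  have h: "h n > 0" "h n \<le> 1" for n by (auto simp: h_def)
  have h0: "h \<longlonglongrightarrow> 0" unfolding h_def by real_asymp
  let ?q = "\<lambda>n w::complex. (exp (of_real (h n) * w) - 1) / (of_real (h n) * w)"
  have k': "l + 1 \<le> real (Suc k)" using assms by simp
  have nz: "Complex c t \<noteq> 0" for t using assms by (simp add: complex_eq_iff)
  have eq: "(integrand (Suc k) s (x + h n) w - integrand (Suc k) s x w) / of_real (h n)
      = integrand k s x w * ?q n w" if "w \<noteq> 0" for n w
  proof -
    have "exp (of_real (x + h n) * w) = exp (of_real x * w) * exp (of_real (h n) * w)"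
      by (simp add: exp_add[symmetric] distrib_right)
    then show ?thesis using that h(1)[of n] by (simp add: integrand_def field_simps)
  qed
  have "(\<lambda>n. CLBINT t. integrand k s x (Complex c t) * ?q n (Complex c t))
    \<longlonglongrightarrow> (CLBINT t. integrand k s x (Complex c t))"
  proof (rule integral_dominated_convergence[where w = "\<lambda>t. exp c * cmod (integrand k s x (Complex c t))"])
    have i: "integrable lborel (\<lambda>t. integrand k s x (Complex c t))"
      by (rule integrand_integrable[OF assms])
    then show m: "(\<lambda>t. integrand k s x (Complex c t)) \<in> borel_measurable lborel"
      by (rule borel_measurable_integrable)
    show "integrable lborel (\<lambda>t. exp c * cmod (integrand k s x (Complex c t)))"
      by (intro integrable_mult_right integrable_norm i)
    have "continuous_on UNIV (\<lambda>t. ?q n (Complex c t))" for n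
    proof -
      have "continuous_on UNIV (\<lambda>t. Complex c t)"
        unfolding Complex_eq by (intro continuous_intros)
      then show ?thesis using nz h(1)[of n] by (intro continuous_intros) auto
    qed
    then show "(\<lambda>t. integrand k s x (Complex c t) * ?q n (Complex c t)) \<in> borel_measurable lborel" for n
      using m by (intro borel_measurable_times) (simp_all add: borel_measurable_continuous_onI)
    have lim: "(\<lambda>n. ?q n w) \<longlonglongrightarrow> 1" if "w \<noteq> 0" for w :: complex
    proof -
      have "(exp has_field_derivative exp 0) (at (0::complex))" by (rule DERIV_exp)
      then have "((\<lambda>z::complex. (exp z - 1) / z) \<longlongrightarrow> 1) (at 0)"
        by (simp add: DERIV_def)
      moreover have "filterlim (\<lambda>n. of_real (h n) * w) (at 0) sequentially"
      proof (rule filterlim_atI)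
        from tendsto_mult[OF tendsto_of_real[OF h0] tendsto_const[of w]]
        show "(\<lambda>n. of_real (h n) * w) \<longlonglongrightarrow> 0" by simp
        show "\<forall>\<^sub>F n in sequentially. of_real (h n) * w \<noteq> 0"
          using that h(1) by (simp add: less_imp_neq[THEN not_sym])
      qed
      ultimately show ?thesis by (rule filterlim_compose)
    qed
    show "AE t in lborel. (\<lambda>n. integrand k s x (Complex c t) * ?q n (Complex c t)) \<longlonglongrightarrow> integrand k s x (Complex c t)"
      using tendsto_mult[OF tendsto_const lim[OF nz]] by (intro AE_I2) simp
    show "AE t in lborel. cmod (integrand k s x (Complex c t) * ?q n (Complex c t))
        \<le> exp c * cmod (integrand k s x (Complex c t))" for n
    proof (rule AE_I2)
      fix t
      let ?z = "of_real (h n) * Complex c t"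
      have "h n * c \<le> 1 * c" using assms h(2) by (intro mult_right_mono) auto
      then have "cmod (exp ?z - 1) \<le> exp c * cmod ?z"
        using assms h(1)[of n] by (intro norm_exp_minus_1_le) auto
      moreover have "cmod ?z > 0" using nz[of t] h(1)[of n] by simp
      ultimately have "cmod (?q n (Complex c t)) \<le> exp c"
        unfolding norm_divide by (simp only: pos_divide_le_eq)
      then have "cmod (integrand k s x (Complex c t)) * cmod (?q n (Complex c t))
         \<le> cmod (integrand k s x (Complex c t)) * exp c"
        by (rule mult_left_mono) simp
      then show "cmod (integrand k s x (Complex c t) * ?q n (Complex c t))
        \<le> exp c * cmod (integrand k s x (Complex c t))"
        by (simp only: norm_mult mult.commute)
    qed
  qed
  moreover have "(CLBINT t. integrand k s x (Complex c t) * ?q n (Complex c t)) =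
     ((CLBINT t. integrand (Suc k) s (x + h n) (Complex c t))
      - (CLBINT t. integrand (Suc k) s x (Complex c t))) / of_real (h n)" for n
  proof -
    have "(CLBINT t. integrand k s x (Complex c t) * ?q n (Complex c t)) =
      (CLBINT t. (integrand (Suc k) s (x + h n) (Complex c t) - integrand (Suc k) s x (Complex c t)) / of_real (h n))"
      using eq[OF nz] by (intro Bochner_Integration.integral_cong) simp_all
    also have "\<dots> = (CLBINT t. integrand (Suc k) s (x + h n) (Complex c t) - integrand (Suc k) s x (Complex c t)) / of_real (h n)"
      by (rule integral_divide_zero)
    also have "(CLBINT t. integrand (Suc k) s (x + h n) (Complex c t) - integrand (Suc k) s x (Complex c t))
      = (CLBINT t. integrand (Suc k) s (x + h n) (Complex c t)) - (CLBINT t. integrand (Suc k) s x (Complex c t))"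
      by (intro Bochner_Integration.integral_diff integrand_integrable k' assms)
    finally show ?thesis .
  qed
  ultimately show ?thesis unfolding h_def by simp
qed

text \<open>Descending induction on the order, far to the right: the germ gives the formula at the
  order k + K0, each step differentiates both sides in x, and at order k the line is moved to the
  abscissa c.\<close>

lemma perron_formula:
  assumes fr: "frequency lam" and germ: "riesz_germ lam a f"
    and k: "l + 1 \<le> real k" and c: "0 < c" and s: "0 < Re s"
  shows "(CLBINT t. integrand k s x (Complex c t)) =
    2 * pi / fact k * (\<Sum>n | lam n < x. a n * exp (- complex_of_real (lam n) * s) * of_real (x - lam n) ^ k)"
proof -
  define b where "b n = a n * exp (- complex_of_real (lam n) * s)" for n
  obtain \<sigma> K0 where P: "\<sigma> \<ge> 0" "K0 \<ge> 1"
    "\<And>K s c x. K \<ge> K0 \<Longrightarrow> 0 < Re s \<Longrightarrow> \<sigma> + 1 \<le> c \<Longrightarrow>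
      (CLBINT t. f (s + Complex c t) * (exp (of_real x * Complex c t) / Complex c t ^ Suc K)) =
      2 * pi / fact K * (\<Sum>n | lam n < x. a n * exp (- complex_of_real (lam n) * s) * of_real (x - lam n) ^ K)"
    using riesz_germ_perron[OF fr germ] by blast
  \<comment> \<open>Large enough for the high-order formula, and strictly beyond c as
    \<open>integrand_shift\<close> demands.\<close>
  define c' where "c' = max (\<sigma> + 1) (c + 1)"
  define Q where "Q K x = 2 * pi / fact K * (\<Sum>n | lam n < x. b n * of_real (x - lam n) ^ K)" for K x
  have k1: "k \<ge> 1" using k l by linarith
  \<comment> \<open>A common index set for all y <= X allows difference quotients term by term; K >=
    1 matters because \<open>0 ^ 0\<close> is 1.\<close>
  have Qmax: "Q K y = 2 * pi / fact K * (\<Sum>n | lam n < X. b n * of_real (max 0 (y - lam n) ^ K))"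
    if "y \<le> X" "K \<ge> 1" for K y X
  proof -
    have "(\<Sum>n | lam n < X. b n * of_real (max 0 (y - lam n) ^ K))
        = (\<Sum>n | lam n < y. b n * of_real (max 0 (y - lam n) ^ K))"
      using that by (intro sum.mono_neutral_right frequency_finite_less[OF fr]) (auto simp: max_def)
    also have "\<dots> = (\<Sum>n | lam n < y. b n * of_real (y - lam n) ^ K)"
      by (intro sum.cong) (auto simp: max_def)
    finally show ?thesis by (simp add: Q_def)
  qed
  have "\<forall>x. (CLBINT t. integrand K s x (Complex c' t)) = Q K x" if "k \<le> K" "K \<le> k + K0" for K
    using that(2,1)
  proof (induction K rule: inc_induct)
    case base
    show ?case using P(3)[of "k + K0" s c'] s by (simp add: integrand_def Q_def b_def c'_def)
  next
    case (step K)
    show ?case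
    proof
      fix x
      let ?h = "\<lambda>n. 1 / real (Suc n)"
      have K: "l + 1 \<le> real K" "K \<ge> 1" using k k1 step.prems by auto
      then obtain K' where K': "K = Suc K'" by (cases K) auto
      have IH: "(CLBINT t. integrand (Suc K) s x (Complex c' t)) = Q (Suc K) x" for x
        using step by auto
      have "(\<lambda>n. (Q (Suc K) (x + ?h n) - Q (Suc K) x) / of_real (?h n))
        \<longlonglongrightarrow> (CLBINT t. integrand K s x (Complex c' t))"
        using integrand_difference_quotient_tendsto[OF K(1) _ s, of c' x] c unfolding IH by (simp add: c'_def)
      moreover have "(\<lambda>n. (Q (Suc K) (x + ?h n) - Q (Suc K) x) / of_real (?h n)) \<longlonglongrightarrow> Q K x"
      proof -
        \<comment> \<open>The cut-off x + 1 covers both arguments, the step being at most 1.\<close>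
        have "(Q (Suc K) (x + ?h n) - Q (Suc K) x) / of_real (?h n) =
          2 * pi / fact (Suc K) * (\<Sum>j | lam j < x + 1. b j *
            of_real ((max 0 ((x - lam j) + ?h n) ^ Suc K - max 0 (x - lam j) ^ Suc K) / ?h n))" for n
        proof -
          have "Q (Suc K) (x + ?h n) - Q (Suc K) x = 2 * pi / fact (Suc K) * (\<Sum>j | lam j < x + 1. b j *
            of_real (max 0 ((x - lam j) + ?h n) ^ Suc K - max 0 (x - lam j) ^ Suc K))"
            by (subst (1 2) Qmax[of _ "x + 1"])
              (simp_all add: right_diff_distrib sum_subtractf algebra_simps del: power_Suc fact_Suc)
          then show ?thesis
            by (simp add: sum_divide_distrib sum_distrib_left sum_distrib_right mult_ac del: power_Suc fact_Suc)
        qed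
        moreover have "(\<lambda>n. 2 * pi / fact (Suc K) * (\<Sum>j | lam j < x + 1. b j *
            of_real ((max 0 ((x - lam j) + ?h n) ^ Suc K - max 0 (x - lam j) ^ Suc K) / ?h n)))
          \<longlonglongrightarrow> 2 * pi / fact (Suc K) * (\<Sum>j | lam j < x + 1. b j * of_real (real (Suc K) * max 0 (x - lam j) ^ K))"
          unfolding K' by (intro tendsto_mult tendsto_sum tendsto_of_real tendsto_const max_0_power_right_difference_quotient)
        moreover have "2 * pi / fact (Suc K) * (\<Sum>j | lam j < x + 1. b j * of_real (real (Suc K) * max 0 (x - lam j) ^ K))
          = Q K x"
        proof -
          have "complex_of_real (2 * pi / fact (Suc K)) * (z * complex_of_real (real (Suc K) * r))
            = complex_of_real (2 * pi / fact K) * (z * complex_of_real r)" for z r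
            by (simp add: fact_Suc del: of_nat_Suc)
          then have "2 * pi / fact (Suc K) * (\<Sum>j | lam j < x + 1. b j * of_real (real (Suc K) * max 0 (x - lam j) ^ K))
            = 2 * pi / fact K * (\<Sum>j | lam j < x + 1. b j * of_real (max 0 (x - lam j) ^ K))"
            unfolding sum_distrib_left by (intro sum.cong refl)
          also have "\<dots> = Q K x" using K(2) by (intro Qmax[symmetric]) simp_all
          finally show ?thesis .
        qed
        ultimately show ?thesis by simp
      qed
      ultimately show "(CLBINT t. integrand K s x (Complex c' t)) = Q K x"
        by (rule LIMSEQ_unique)
    qed
  qed
  then have "(CLBINT t. integrand k s x (Complex c' t)) = Q k x" by simp
  moreover have "(CLBINT t. integrand k s x (Complex c t)) = (CLBINT t. integrand k s x (Complex c' t))"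
    using k c s by (intro integrand_shift) (auto simp: c'_def)
  ultimately show ?thesis by (simp add: Q_def b_def)
qed

end

subsection \<open>Approximation by Riesz means\<close>

context growth_function
begin

text \<open>Cauchy's inequality on the disc of radius u / 2, which stays in Re > 0 and on which the
  weight grows at most by the factor (1 + u / 2)^l.\<close>

lemma deriv_bound:
  assumes "0 < u" "u \<le> Re z"
  shows "cmod (deriv f z) \<le> 2 / u * (1 + u / 2) powr l * C * (1 + cmod z) powr l"
proof -
  have sub: "cball z (u / 2) \<subseteq> {s. 0 < Re s}"
  proof
    fix y assume "y \<in> cball z (u / 2)"
    then have "\<bar>Re (z - y)\<bar> \<le> u / 2"
      using abs_Re_le_cmod[of "z - y"] by (simp add: dist_norm)
    then have "Re z - Re y \<le> u / 2" by (simp only: abs_le_iff minus_complex.simps)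
    then show "y \<in> {s. 0 < Re s}" using assms by simp
  qed
  have "cmod ((deriv ^^ 1) f z) \<le> fact 1 * (C * ((1 + u / 2) powr l * (1 + cmod z) powr l)) / (u / 2) ^ 1"
  proof (rule Cauchy_inequality)
    show "f holomorphic_on ball z (u / 2)"
      using sub ball_subset_cball by (intro holomorphic_on_subset[OF hol]) blast
    show "continuous_on (cball z (u / 2)) f"
      by (intro holomorphic_on_imp_continuous_on holomorphic_on_subset[OF hol sub])
    fix y assume y: "cmod (z - y) = u / 2"
    then have "0 < Re y" using sub by (auto simp: dist_norm)
    then have "cmod (f y) \<le> C * (1 + cmod y) powr l" by (rule growth)
    also have "\<dots> \<le> C * ((1 + u / 2) * (1 + cmod z)) powr l"
    proof (intro mult_left_mono powr_mono2 C_nonneg l)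
      have "cmod y \<le> cmod z + u / 2"
        using norm_triangle_ineq4[of z "z - y"] y by simp
      moreover have "0 \<le> u / 2 * cmod z" using assms by simp
      moreover have "(1 + u / 2) * (1 + cmod z) = 1 + cmod z + u / 2 + u / 2 * cmod z"
        by (simp add: distrib_left distrib_right)
      ultimately show "1 + cmod y \<le> (1 + u / 2) * (1 + cmod z)" by linarith
    qed auto
    also have "\<dots> = C * ((1 + u / 2) powr l * (1 + cmod z) powr l)"
      using assms by (simp add: powr_mult)
    finally show "cmod (f y) \<le> C * ((1 + u / 2) powr l * (1 + cmod z) powr l)" .
  qed (use assms in auto)
  then show ?thesis by (simp add: mult_ac)
qed

text \<open>Mean value estimate along the segment from s to s + w, which stays in Re >= u because Re
  w >= 0, so \<open>deriv_bound\<close> holds on all of it.\<close>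

lemma difference_bound:
  assumes "0 < u" "u \<le> Re s" "0 \<le> Re w"
  shows "cmod (f (s + w) - f s)
    \<le> 2 / u * (1 + u / 2) powr l * C * ((1 + cmod s) powr l * (1 + cmod w) powr l) * cmod w"
proof -
  let ?D = "2 / u * (1 + u / 2) powr l * C"
  have D: "?D \<ge> 0" using assms C_nonneg by simp
  have "cmod (f (s + w) - f s) \<le> ?D * ((1 + cmod s) powr l * (1 + cmod w) powr l) * cmod (s + w - s)"
  proof (rule field_differentiable_bound[where S = "closed_segment s (s + w)" and f' = "deriv f"])
    fix z assume "z \<in> closed_segment s (s + w)"
    then obtain t where t: "0 \<le> t" "t \<le> 1" "z = s + of_real t * w"
      by (auto simp: in_segment scaleR_conv_of_real algebra_simps)
    have Re: "u \<le> Re z" using t assms by (simp add: add_increasing2)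
    then have "f field_differentiable at z"
      using assms by (intro holomorphic_on_imp_differentiable_at[OF hol] open_halfspace_Re_gt) auto
    then show "(f has_field_derivative deriv f z) (at z within closed_segment s (s + w))"
      using field_differentiable_derivI has_field_derivative_at_within by blast
    have "cmod z \<le> cmod s + t * cmod w"
      unfolding t(3) using norm_triangle_ineq[of s "of_real t * w"] t(1) by (simp add: norm_mult)
    also have "\<dots> \<le> cmod s + 1 * cmod w" using t by (intro add_mono mult_right_mono) auto
    also have "\<dots> \<le> cmod s + cmod w + cmod s * cmod w" by simp
    finally have "1 + cmod z \<le> (1 + cmod s) * (1 + cmod w)" by (simp add: algebra_simps)
    then have "(1 + cmod z) powr l \<le> ((1 + cmod s) * (1 + cmod w)) powr l"
      using l by (intro powr_mono2) auto
    then have "(1 + cmod z) powr l \<le> (1 + cmod s) powr l * (1 + cmod w) powr l"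
      by (simp add: powr_mult)
    then show "cmod (deriv f z) \<le> ?D * ((1 + cmod s) powr l * (1 + cmod w) powr l)"
      using D by (intro order_trans[OF deriv_bound[OF assms(1) Re]] mult_left_mono)
  qed auto
  then show ?thesis by simp
qed

text \<open>As the kernel has mass one, the error is the integral of f(s + w) - f(s) against it. On
  Re w = 1/x the factor exp (x w) has modulus e, and the weight in w is estimated by powers of x |w|
  >= 1. The resulting majorant x^(k-2) / |w|^2 integrates to pi x^(k-1), and the normalization k! /
  (2 pi x^k) leaves 1/x.\<close>

lemma riesz_mean_approximation:
  assumes fr: "frequency lam" and germ: "riesz_germ lam a f"
    and k: "l + 2 \<le> real k" and u: "0 < u" and s: "u \<le> Re s" and x: "1 \<le> x"
  shows "cmod (riesz_mean lam a (real k) x s - f s)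
    \<le> fact k / 2 * exp 1 * 2 powr l * (2 / u * (1 + u / 2) powr l * C) / x * (1 + cmod s) powr l"
proof -
  let ?D = "2 / u * (1 + u / 2) powr l * C"
  define c where "c = 1 / x"
  have c: "0 < c" "x * c = 1" using x by (auto simp: c_def)
  have k1: "l + 1 \<le> real k" "k \<ge> 1" using k l by linarith+
  have D: "?D \<ge> 0" using u C_nonneg by simp
  have s0: "0 < Re s" using u s by simp
  let ?K = "\<lambda>w. exp (of_real x * w) / w ^ Suc k"
  define r where "r = fact k / (2 * pi * x ^ k)"
  have r0: "r \<ge> 0" using x by (simp add: r_def)
  have "riesz_mean lam a (real k) x s = of_real r * (CLBINT t. integrand k s x (Complex c t))"
    using x by (simp add: perron_formula[OF fr germ k1(1) c(1) s0] riesz_mean_nat r_def)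
  moreover have "f s = of_real r * (CLBINT t. f s * ?K (Complex c t))"
    using x by (simp only: integral_mult_right_zero perron_kernel[OF c(1) k1(2)]) (simp add: r_def)
  moreover have "(CLBINT t. integrand k s x (Complex c t)) - (CLBINT t. f s * ?K (Complex c t))
      = (CLBINT t. integrand k s x (Complex c t) - f s * ?K (Complex c t))"
    by (intro Bochner_Integration.integral_diff[symmetric] integrand_integrable integrable_mult_right
      perron_kernel_integrable k1 c(1) s0)
  ultimately have eq: "riesz_mean lam a (real k) x s - f s
      = of_real r * (CLBINT t. integrand k s x (Complex c t) - f s * ?K (Complex c t))"
    by (metis right_diff_distrib)
  define M where "M = ?D * (1 + cmod s) powr l * exp 1 * 2 powr l * x ^ k / x\<^sup>2"
  have "cmod (CLBINT t. integrand k s x (Complex c t) - f s * ?K (Complex c t)) \<le> M * pi / c"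
  proof (rule norm_vertical_integral_le[OF c(1)])
    fix t
    let ?w = "Complex c t"
    let ?W = "cmod ?w"
    have W: "c \<le> ?W" using complex_Re_le_cmod[of ?w] by simp
    then have W0: "0 < ?W" using c by linarith
    have xW: "1 \<le> x * ?W" using mult_left_mono[OF W, of x] c x by simp
    have "1 * ?W \<le> x * ?W" using x by (intro mult_right_mono) auto
    then have "1 + ?W \<le> 2 * (x * ?W)" using xW by simp
    then have "(1 + ?W) powr l \<le> (2 * (x * ?W)) powr l" using l by (intro powr_mono2) auto
    also have "\<dots> = 2 powr l * (x * ?W) powr l" using x by (simp add: powr_mult)
    \<comment> \<open>Because x |w| >= 1, the exponent l can be raised to k - 2; this is where
      \<open>l + 2 \<le> real k\<close> enters.\<close>
    also have "\<dots> \<le> 2 powr l * (x * ?W) powr (real k - 2)"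
      using xW k by (intro mult_left_mono powr_mono) auto
    also have "(x * ?W) powr (real k - 2) = (x * ?W) ^ k / (x * ?W)\<^sup>2"
      using xW powr_realpow[of "x * ?W" k] powr_realpow[of "x * ?W" 2] by (simp add: powr_diff)
    finally have 1: "(1 + ?W) powr l \<le> 2 powr l * ((x * ?W) ^ k / (x * ?W)\<^sup>2)" .
    have "integrand k s x ?w - f s * ?K ?w = (f (s + ?w) - f s) * ?K ?w"
      by (simp only: integrand_def left_diff_distrib)
    then have "cmod (integrand k s x ?w - f s * ?K ?w) = cmod (f (s + ?w) - f s) * (exp 1 / ?W ^ Suc k)"
      using c by (simp add: norm_mult norm_divide norm_power)
    also have "\<dots> \<le> (?D * ((1 + cmod s) powr l * (1 + ?W) powr l) * ?W) * (exp 1 / ?W ^ Suc k)"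
      using c(1) by (intro mult_right_mono difference_bound[OF u s]) auto
    also have "\<dots> \<le> (?D * ((1 + cmod s) powr l * (2 powr l * ((x * ?W) ^ k / (x * ?W)\<^sup>2))) * ?W) * (exp 1 / ?W ^ Suc k)"
      using 1 D by (intro mult_right_mono mult_left_mono) auto
    also have "\<dots> = M / ?W\<^sup>2"
      using W0 x by (simp add: M_def power_mult_distrib field_simps)
    finally show "cmod (integrand k s x ?w - f s * ?K ?w) \<le> M / (c\<^sup>2 + t\<^sup>2)"
      by (simp add: cmod_power2)
  qed
  then have "cmod (riesz_mean lam a (real k) x s - f s) \<le> r * (M * pi / c)"
    unfolding eq norm_mult norm_of_real abs_of_nonneg[OF r0] using r0 by (rule mult_left_mono)
  also have "\<dots> = fact k / 2 * exp 1 * 2 powr l * ?D / x * (1 + cmod s) powr l"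
    using x by (simp add: r_def M_def c_def power2_eq_square field_simps)
  finally show ?thesis .
qed

end

section \<open>The weighted norm, translates, and dependence on the coefficients\<close>

lemma H_inf_space_iff:
  assumes "0 \<le> l"
  shows "f \<in> H_inf_space lam l \<longleftrightarrow>
    (\<exists>a. riesz_germ lam a f) \<and> (\<exists>C. \<forall>s. 0 < Re s \<longrightarrow> cmod (f s) \<le> C * (1 + cmod s) powr l)"
proof -
  have "cmod (f s) / (1 + cmod s) powr l \<le> C \<longleftrightarrow> cmod (f s) \<le> C * (1 + cmod s) powr l" for s C
    by (intro pos_divide_le_eq) (simp add: add_pos_nonneg less_imp_neq[THEN not_sym])
  then show ?thesis
    by (auto simp: H_inf_space_def bdd_above_def right_half_plane_def riesz_germ_def)
qed

lemma H_inf_norm_bound: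
  assumes "f \<in> H_inf_space lam l" "H_inf_norm l f \<le> C" "0 < Re s"
  shows "cmod (f s) \<le> C * (1 + cmod s) powr l"
proof -
  have "cmod (f s) / (1 + cmod s) powr l \<le> H_inf_norm l f"
    unfolding H_inf_norm_def using assms
    by (intro cSUP_upper) (auto simp: H_inf_space_def right_half_plane_def)
  then have "cmod (f s) / (1 + cmod s) powr l \<le> C" using assms by simp
  then show ?thesis by (simp add: pos_divide_le_eq add_pos_nonneg less_imp_neq[THEN not_sym])
qed

text \<open>The real supremum behaves as expected because the hypothesis bounds the quotients; the
  quotient at s = 1 shows that it is nonnegative.\<close>

lemma H_inf_norm_le:
  assumes "\<And>s. 0 < Re s \<Longrightarrow> cmod (g s) \<le> e * (1 + cmod s) powr l"
  shows "\<bar>H_inf_norm l g\<bar> \<le> e"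
proof -
  have le: "cmod (g s) / (1 + cmod s) powr l \<le> e" if "s \<in> right_half_plane 0" for s
    using assms[of s] that
    by (simp add: pos_divide_le_eq add_pos_nonneg less_imp_neq[THEN not_sym] right_half_plane_def)
  have 1: "(1::complex) \<in> right_half_plane 0" by (simp add: right_half_plane_def)
  have "H_inf_norm l g \<le> e"
    unfolding H_inf_norm_def using 1 le by (intro cSUP_least) auto
  moreover have "0 \<le> cmod (g 1) / (1 + cmod 1) powr l" by simp
  moreover have "\<dots> \<le> H_inf_norm l g"
    unfolding H_inf_norm_def using 1 le by (intro cSUP_upper) (auto simp: bdd_above_def)
  ultimately show ?thesis by linarith
qed

lemma one_plus_cmod_add_powr_le:
  assumes "0 \<le> l"
  shows "(1 + cmod (s + z)) powr l \<le> (1 + cmod s) powr l * (1 + cmod z) powr l"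
proof -
  have "(1 + cmod s) * (1 + cmod z) = 1 + cmod s + cmod z + cmod s * cmod z" by (simp add: algebra_simps)
  moreover have "0 \<le> cmod s * cmod z" by (intro mult_nonneg_nonneg) auto
  ultimately have "1 + cmod (s + z) \<le> (1 + cmod s) * (1 + cmod z)"
    using norm_triangle_ineq[of s z] by linarith
  then have "(1 + cmod (s + z)) powr l \<le> ((1 + cmod s) * (1 + cmod z)) powr l"
    using assms by (intro powr_mono2) auto
  then show ?thesis by (simp add: powr_mult)
qed

text \<open>The translate has the germ with coefficients a_n exp (-lam_n u), with the same order and
  abscissa; its weight costs the factor (1 + u)^l.\<close>

lemma H_inf_space_translate:
  assumes l: "0 \<le> l" and f: "f \<in> H_inf_space lam l" and u: "0 < u"
  shows "(\<lambda>s. f (complex_of_real u + s)) \<in> H_inf_space lam l"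
proof -
  obtain a C where germ: "riesz_germ lam a f"
    and C: "\<And>s. 0 < Re s \<Longrightarrow> cmod (f s) \<le> C * (1 + cmod s) powr l"
    using f H_inf_space_iff[OF l] by blast
  let ?b = "\<lambda>n. a n * exp (- complex_of_real (lam n) * of_real u)"
  have rm: "riesz_mean lam ?b m x s = riesz_mean lam a m x (of_real u + s)" for m x s
    unfolding riesz_mean_def by (intro sum.cong refl) (simp add: distrib_left exp_diff exp_minus exp_add field_simps)
  obtain m \<sigma> where m: "m \<ge> 0" "\<sigma> \<ge> 0"
      "\<And>s. \<sigma> < Re s \<Longrightarrow> ((\<lambda>x. riesz_mean lam a m x s) \<longlongrightarrow> f s) at_top"
    and hol: "f holomorphic_on right_half_plane 0"
    using germ by (auto simp: riesz_germ_def right_half_plane_def)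
  have "(\<lambda>s. f (of_real u + s)) holomorphic_on right_half_plane 0"
    using u by (intro holomorphic_on_compose_gen[OF _ hol, unfolded o_def] holomorphic_intros)
      (auto simp: right_half_plane_def)
  moreover have "((\<lambda>x. riesz_mean lam ?b m x s) \<longlongrightarrow> f (of_real u + s)) at_top"
    if "s \<in> right_half_plane \<sigma>" for s
    unfolding rm using that u by (intro m(3)) (auto simp: right_half_plane_def)
  ultimately have "riesz_germ lam ?b (\<lambda>s. f (of_real u + s))"
    unfolding riesz_germ_def using m(1,2) by blast
  moreover have "cmod (f (of_real u + s)) \<le> C * (1 + u) powr l * (1 + cmod s) powr l" if "0 < Re s" for s
  proof -
    have C0: "C \<ge> 0" using order_trans[OF norm_ge_zero C[of 1]] by (simp add: zero_le_mult_iff)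
    have "cmod (f (of_real u + s)) \<le> C * (1 + cmod (of_real u + s)) powr l"
      using that u by (intro C) auto
    also have "\<dots> \<le> C * ((1 + cmod (of_real u)) powr l * (1 + cmod s) powr l)"
      using C0 l by (intro mult_left_mono one_plus_cmod_add_powr_le)
    finally show ?thesis using u by (simp add: mult.assoc)
  qed
  ultimately show ?thesis unfolding H_inf_space_iff[OF l] by blast
qed

text \<open>On Re s >= 0 the exponentials and the Riesz weights are at most 1, so at fixed x the
  estimate is uniform in s.\<close>

lemma riesz_mean_diff_bound:
  assumes fr: "frequency lam" and "0 \<le> m" "0 < x" "0 \<le> Re s"
  shows "cmod (riesz_mean lam a m x s - riesz_mean lam b m x s) \<le> (\<Sum>n | lam n < x. cmod (a n - b n))"
proof -
  have "riesz_mean lam a m x s - riesz_mean lam b m x s = riesz_mean lam (\<lambda>n. a n - b n) m x s"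
    unfolding riesz_mean_def by (simp add: sum_subtractf left_diff_distrib)
  also have "cmod \<dots> \<le> (\<Sum>n | lam n < x. cmod (a n - b n))"
    unfolding riesz_mean_def
  proof (rule sum_norm_le)
    fix n assume n: "n \<in> {n. lam n < x}"
    have "(1 - lam n / x) powr m \<le> 1"
      using n assms frequency_nonneg[OF fr, of n] by (intro powr_le1) auto
    moreover have "cmod (exp (- complex_of_real (lam n) * s)) \<le> 1"
      using assms frequency_nonneg[OF fr, of n] by simp
    ultimately have "cmod (exp (- complex_of_real (lam n) * s)) * (1 - lam n / x) powr m \<le> 1 * 1"
      by (intro mult_mono) auto
    then show "cmod ((a n - b n) * exp (- complex_of_real (lam n) * s) * complex_of_real ((1 - lam n / x) powr m))
      \<le> cmod (a n - b n)"
      unfolding norm_mult mult.assoc by (intro mult_left_le) auto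
  qed
  finally show ?thesis .
qed

section \<open>Convergence of the bounded sequence\<close>

theorem theorem3p15:
  fixes lam :: "nat \<Rightarrow> real" and l :: real
    and F :: "nat \<Rightarrow> complex \<Rightarrow> complex" and a :: "nat \<Rightarrow> complex"
  assumes "frequency lam"
    and "0 \<le> l"
    and "\<And>N. F N \<in> H_inf_space lam l"
    and "\<exists>C. \<forall>N. H_inf_norm l (F N) \<le> C"
    and "\<And>n. (\<lambda>N. bohr_coeff lam (F N) n) \<longlonglongrightarrow> a n"
  shows "\<exists>f\<in>H_inf_space lam l.
           (\<forall>n. bohr_coeff lam f n = a n) \<and>
           (\<forall>u>0. H_inf_tendsto lam l
                    (\<lambda>N s. F N (complex_of_real u + s))
                    (\<lambda>s. f (complex_of_real u + s)))"
proof -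
  note fr = assms(1) and l = assms(2)
  obtain C where C: "\<And>N. H_inf_norm l (F N) \<le> C" using assms(4) by blast
  define A where "A N = bohr_coeff lam (F N)" for N
  have A: "(\<lambda>N. A N n) \<longlonglongrightarrow> a n" for n using assms(5) by (simp add: A_def)
  have germ: "riesz_germ lam (A N) (F N)" for N
    using assms(3)[of N] bohr_coeff_eq[OF fr] by (auto simp: H_inf_space_def A_def)
  have growth: "cmod (F N s) \<le> C * (1 + cmod s) powr l" if "0 < Re s" for N s
    by (rule H_inf_norm_bound[OF assms(3) C that])
  have hol: "F N holomorphic_on {s. 0 < Re s}" for N
    using assms(3)[of N] by (simp add: H_inf_space_def right_half_plane_def)
  interpret F: growth_function "F N" C l for N
    by standard (use hol growth l in auto)
  have C0: "C \<ge> 0" by (rule F.C_nonneg)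
  define k where "k = nat \<lceil>l\<rceil> + 2"
  have k: "l + 2 \<le> real k" unfolding k_def by linarith
  define B where "B u = fact k / 2 * exp 1 * 2 powr l * (2 / u * (1 + u / 2) powr l * C)" for u
  have B0: "B u \<ge> 0" if "u > 0" for u using that C0 by (simp add: B_def)
  have approx: "cmod (riesz_mean lam (A N) (real k) x s - F N s) \<le> B u / x * (1 + cmod s) powr l"
    if "0 < u" "u \<le> Re s" "1 \<le> x" for N u s x
    unfolding B_def by (rule F.riesz_mean_approximation[OF fr germ k that])
  have weight: "1 \<le> (1 + cmod s) powr l" for s
    using l by (intro ge_one_powr_ge_zero) auto
  have cauchy: "\<exists>N0. \<forall>M\<ge>N0. \<forall>N\<ge>N0. \<forall>s. u \<le> Re s \<longrightarrow> cmod (F M s - F N s) \<le> e * (1 + cmod s) powr l"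
    if u: "u > 0" and e: "e > 0" for u e :: real
  proof -
    \<comment> \<open>Chosen to bring the approximation error below a quarter of e for all N at
      once; with x fixed, only finitely many coefficients matter.\<close>
    define x where "x = max 1 (4 * B u / e)"
    have x: "1 \<le> x" "B u / x \<le> e / 4"
    proof -
      show "1 \<le> x" by (simp add: x_def)
      have "4 * B u / e \<le> x" by (simp add: x_def)
      then show "B u / x \<le> e / 4" using e \<open>1 \<le> x\<close> by (simp add: field_simps)
    qed
    have "(\<lambda>N. \<Sum>n | lam n < x. cmod (A N n - a n)) \<longlonglongrightarrow> (\<Sum>n | lam n < x. cmod (a n - a n))"
      by (intro tendsto_sum tendsto_norm tendsto_diff tendsto_const A)
    then have "eventually (\<lambda>N. (\<Sum>n | lam n < x. cmod (A N n - a n)) < e / 4) sequentially"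
      using e by (intro order_tendstoD(2)) auto
    then obtain N0 where N0: "\<And>N. N \<ge> N0 \<Longrightarrow> (\<Sum>n | lam n < x. cmod (A N n - a n)) < e / 4"
      by (auto simp: eventually_sequentially)
    have "cmod (F M s - F N s) \<le> e * (1 + cmod s) powr l"
      if MN: "M \<ge> N0" "N \<ge> N0" and s: "u \<le> Re s" for M N s
    proof -
      let ?R = "\<lambda>b. riesz_mean lam b (real k) x s"
      let ?W = "(1 + cmod s) powr l"
      have ap: "cmod (?R (A N) - F N s) \<le> e / 4 * ?W" for N
        using x(2) by (intro order_trans[OF approx[OF u s x(1)]] mult_right_mono) auto
      have co: "cmod (?R (A N) - ?R a) \<le> e / 4 * ?W" if "N \<ge> N0" for N
      proof -
        have "cmod (?R (A N) - ?R a) \<le> (\<Sum>n | lam n < x. cmod (A N n - a n))"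
          using x u s by (intro riesz_mean_diff_bound[OF fr]) auto
        also have "\<dots> \<le> e / 4 * 1" using N0[OF that] by simp
        also have "\<dots> \<le> e / 4 * ?W" using weight e by (intro mult_left_mono) auto
        finally show ?thesis .
      qed
      have tri: "cmod (p - q - r + t) \<le> cmod p + cmod q + cmod r + cmod t" for p q r t :: complex
        using norm_triangle_ineq[of "p - q - r" t] norm_triangle_ineq4[of "p - q" r] norm_triangle_ineq4[of p q]
        by linarith
      \<comment> \<open>Both functions are compared with the Riesz mean of the limit coefficients:
        two approximation errors and two coefficient errors, a quarter of e each.\<close>
      have "F M s - F N s = (?R (A M) - ?R a) - (?R (A M) - F M s) - (?R (A N) - ?R a) + (?R (A N) - F N s)"
        by simp
      then have "cmod (F M s - F N s)
          \<le> cmod (?R (A M) - ?R a) + cmod (?R (A M) - F M s) + cmod (?R (A N) - ?R a) + cmod (?R (A N) - F N s)"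
        by (simp only: tri)
      also have "\<dots> \<le> e / 4 * ?W + e / 4 * ?W + e / 4 * ?W + e / 4 * ?W"
        by (intro add_mono ap co MN)
      finally show ?thesis by simp
    qed
    then show ?thesis by blast
  qed
  define f where "f s = lim (\<lambda>N. F N s)" for s
  have lim: "(\<lambda>N. F N s) \<longlonglongrightarrow> f s" if s: "0 < Re s" for s
  proof -
    have "Cauchy (\<lambda>N. F N s)"
    proof (rule CauchyI)
      fix e :: real assume e: "0 < e"
      let ?e = "e / 2 / (1 + cmod s) powr l"
      have W: "(1 + cmod s) powr l > 0" using weight[of s] by linarith
      then have "?e > 0" using e by simp
      from cauchy[OF s this] obtain N0 where N0:
        "\<And>M N. M \<ge> N0 \<Longrightarrow> N \<ge> N0 \<Longrightarrow> cmod (F M s - F N s) \<le> ?e * (1 + cmod s) powr l" by blast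
      have "?e * (1 + cmod s) powr l < e" using W e by simp
      then show "\<exists>M. \<forall>m\<ge>M. \<forall>n\<ge>M. cmod (F m s - F n s) < e"
        using N0 by (intro exI[of _ N0]) (auto intro: le_less_trans)
    qed
    then show ?thesis by (simp add: f_def Cauchy_convergent_iff convergent_LIMSEQ_iff)
  qed
  have unif: "\<exists>N0. \<forall>N\<ge>N0. \<forall>s. u \<le> Re s \<longrightarrow> cmod (F N s - f s) \<le> e * (1 + cmod s) powr l"
    if u: "u > 0" and e: "e > 0" for u e :: real
  proof -
    obtain N0 where N0: "\<And>M N s. M \<ge> N0 \<Longrightarrow> N \<ge> N0 \<Longrightarrow> u \<le> Re s \<Longrightarrow>
        cmod (F M s - F N s) \<le> e * (1 + cmod s) powr l"
      using cauchy[OF u e] by blast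
    have "cmod (F N s - f s) \<le> e * (1 + cmod s) powr l" if "N \<ge> N0" "u \<le> Re s" for N s
    proof (rule LIMSEQ_le_const2)
      show "(\<lambda>M. cmod (F N s - F M s)) \<longlonglongrightarrow> cmod (F N s - f s)"
        using that u by (intro tendsto_norm tendsto_diff tendsto_const lim) auto
      show "\<exists>K. \<forall>M\<ge>K. cmod (F N s - F M s) \<le> e * (1 + cmod s) powr l"
        using N0 that by blast
    qed
    then show ?thesis by blast
  qed
  have f_growth: "cmod (f s) \<le> C * (1 + cmod s) powr l" if "0 < Re s" for s
    using growth[OF that] by (intro LIMSEQ_le_const2[OF tendsto_norm[OF lim[OF that]]]) auto
  have f_hol: "f holomorphic_on {s. 0 < Re s}"
  proof (rule holomorphic_uniform_sequence[OF open_halfspace_Re_gt hol])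
    fix z assume z: "z \<in> {s. 0 < Re s}"
    \<comment> \<open>The disc of radius Re z / 2 lies in Re >= d, where the convergence is uniform
      up to the weight; \<open>W\<close> below bounds the weight on the disc.\<close>
    define d where "d = Re z / 2"
    have d: "d > 0" using z by (simp add: d_def)
    have Re: "d \<le> Re s" if "s \<in> cball z d" for s
      using that abs_Re_le_cmod[of "z - s"] by (auto simp: dist_norm d_def)
    have "uniform_limit (cball z d) F f sequentially"
    proof (rule uniform_limitI)
      fix e :: real assume e: "0 < e"
      define W where "W = (1 + cmod z + d) powr l"
      have W: "W > 0" using d by (simp add: W_def add_pos_nonneg add_nonneg_pos less_imp_neq[THEN not_sym])
      from unif[OF d, of "e / 2 / W"] e W obtain N0 where N0:
        "\<And>N s. N \<ge> N0 \<Longrightarrow> d \<le> Re s \<Longrightarrow> cmod (F N s - f s) \<le> e / 2 / W * (1 + cmod s) powr l" by auto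
      show "\<forall>\<^sub>F N in sequentially. \<forall>s\<in>cball z d. dist (F N s) (f s) < e"
      proof (intro eventually_sequentiallyI[of N0] ballI)
        fix N s assume N: "N0 \<le> N" and s: "s \<in> cball z d"
        have "cmod s \<le> cmod z + d"
          using s norm_triangle_ineq4[of z "z - s"] by (simp add: dist_norm)
        then have "(1 + cmod s) powr l \<le> W" unfolding W_def using l by (intro powr_mono2) auto
        then have "e / 2 / W * (1 + cmod s) powr l \<le> e / 2 / W * W"
          using e W by (intro mult_left_mono) auto
        also have "\<dots> < e" using e W by simp
        finally show "dist (F N s) (f s) < e"
          using N0[OF N Re[OF s]] by (simp add: dist_norm)
      qed
    qed
    moreover have "cball z d \<subseteq> {s. 0 < Re s}" using Re d by fastforce
    ultimately show "\<exists>d>0. cball z d \<subseteq> {s. 0 < Re s} \<and> uniform_limit (cball z d) F f sequentially"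
      using d by blast
  qed
  \<comment> \<open>At fixed x the Riesz mean is a finite sum, so N can tend to infinity in the
    error bound, whose constant does not involve N. This gives the germ of the limit with order k
    and abscissa 0.\<close>
  have f_approx: "cmod (riesz_mean lam a (real k) x s - f s) \<le> B (Re s) / x * (1 + cmod s) powr l"
    if s: "0 < Re s" and x: "1 \<le> x" for s x
  proof (rule LIMSEQ_le_const2)
    show "(\<lambda>N. cmod (riesz_mean lam (A N) (real k) x s - F N s)) \<longlonglongrightarrow> cmod (riesz_mean lam a (real k) x s - f s)"
        unfolding riesz_mean_def
      by (intro tendsto_norm tendsto_diff tendsto_sum tendsto_mult tendsto_const A lim s)
  qed (use approx[OF s order_refl x] in blast)
  have f_conv: "((\<lambda>x. riesz_mean lam a (real k) x s) \<longlongrightarrow> f s) at_top" if s: "0 < Re s" for s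
  proof -
    have "((\<lambda>x. riesz_mean lam a (real k) x s - f s) \<longlongrightarrow> 0) at_top"
    proof (rule Lim_null_comparison)
      show "\<forall>\<^sub>F x in at_top. cmod (riesz_mean lam a (real k) x s - f s) \<le> B (Re s) / x * (1 + cmod s) powr l"
        using f_approx[OF s] by (intro eventually_at_top_linorderI[of 1])
      show "((\<lambda>x. B (Re s) / x * (1 + cmod s) powr l) \<longlongrightarrow> 0) at_top" by real_asymp
    qed
    then show ?thesis by (simp only: LIM_zero_iff)
  qed
  have f_germ: "riesz_germ lam a f"
  proof -
    have "\<exists>\<sigma>\<ge>0. \<forall>s\<in>right_half_plane \<sigma>. ((\<lambda>x. riesz_mean lam a (real k) x s) \<longlongrightarrow> f s) at_top"
      using f_conv by (intro exI[of _ 0]) (simp add: right_half_plane_def)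
    then have "\<exists>m\<ge>0. \<exists>\<sigma>\<ge>0. \<forall>s\<in>right_half_plane \<sigma>. ((\<lambda>x. riesz_mean lam a m x s) \<longlongrightarrow> f s) at_top"
      by (intro exI[of _ "real k"]) simp
    then show ?thesis
      unfolding riesz_germ_def using f_hol by (simp add: right_half_plane_def)
  qed
  have f_space: "f \<in> H_inf_space lam l"
    unfolding H_inf_space_iff[OF l] using f_germ f_growth by blast
  have "H_inf_tendsto lam l (\<lambda>N s. F N (complex_of_real u + s)) (\<lambda>s. f (complex_of_real u + s))"
    if u: "u > 0" for u
    unfolding H_inf_tendsto_def
  proof (intro conjI allI H_inf_space_translate l f_space assms(3) u)
    show "(\<lambda>N. H_inf_norm l (\<lambda>s. F N (of_real u + s) - f (of_real u + s))) \<longlonglongrightarrow> 0"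
    proof (rule LIMSEQ_I)
      fix e :: real assume e: "0 < e"
      \<comment> \<open>The weight at u + s exceeds the weight at s by at most this factor, hence
        the division of the tolerance by \<open>V\<close>.\<close>
      define V where "V = (1 + u) powr l"
      have V: "V > 0" using u by (simp add: V_def)
      from unif[OF u, of "e / 2 / V"] e V obtain N0 where N0:
        "\<And>N s. N \<ge> N0 \<Longrightarrow> u \<le> Re s \<Longrightarrow> cmod (F N s - f s) \<le> e / 2 / V * (1 + cmod s) powr l" by auto
      have "norm (H_inf_norm l (\<lambda>s. F N (of_real u + s) - f (of_real u + s)) - 0) < e" if "N \<ge> N0" for N
      proof -
        have "\<bar>H_inf_norm l (\<lambda>s. F N (of_real u + s) - f (of_real u + s))\<bar> \<le> e / 2"
        proof (rule H_inf_norm_le)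
          fix s :: complex assume s: "0 < Re s"
          have "cmod (F N (of_real u + s) - f (of_real u + s)) \<le> e / 2 / V * (1 + cmod (of_real u + s)) powr l"
            using that s by (intro N0) auto
          also have "\<dots> \<le> e / 2 / V * ((1 + cmod (of_real u)) powr l * (1 + cmod s) powr l)"
            using e V l by (intro mult_left_mono one_plus_cmod_add_powr_le) auto
          also have "\<dots> = e / 2 * (1 + cmod s) powr l" using u V by (simp add: V_def)
          finally show "cmod (F N (of_real u + s) - f (of_real u + s)) \<le> e / 2 * (1 + cmod s) powr l" .
        qed
        then show ?thesis using e by simp
      qed
      then show "\<exists>N0. \<forall>N\<ge>N0. norm (H_inf_norm l (\<lambda>s. F N (of_real u + s) - f (of_real u + s)) - 0) < e"
        by blast
    qed
  qed
  then show ?thesis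
    using f_space bohr_coeff_eq[OF fr f_germ] by (intro bexI[of _ f]) auto
qed

end
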